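(* Let $M$ be a manifold of dimension $n$. If $N \geq \left[\frac{3n}{2}\right]$, then there exists a totally real immersion of $M$ into $\mathbf{C}^N$.
   Context: All manifolds are smooth (real, without boundary) and second countable. $[x]$ denotes the greatest integer $\le x$. A smooth immersion $f: M \to \mathbf{C}^N$ is called totally real if $f_*(TM)$ contains no complex line, equivalently $f_*(T_pM)\cap i\,(f_*(T_pM))=\{0\}$ for every $p \in M$, where $f_*(T_pM)$ is regarded as a real subspace of $T_{f(p)}\mathbf{C}^N \cong \mathbf{C}^N$. *)

theory Defs
  imports "HOL-Analysis.Analysis"
begin

primrec Ck_on :: "nat \<Rightarrow> 'e::real_normed_vector set \<Rightarrow> ('e \<Rightarrow> 'f::real_normed_vector) \<Rightarrow> bool" where
  "Ck_on 0 W f \<longleftrightarrow> continuous_on W f"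
| "Ck_on (Suc k) W f \<longleftrightarrow>
     (\<forall>x\<in>W. f differentiable (at x)) \<and> (\<forall>v. Ck_on k W (\<lambda>x. frechet_derivative f (at x) v))"

text \<open>Smoothness on a possibly non-open set is understood, as usual, as local extendability to a
  smooth function on an open set. It is only used below for relatively open subsets of a linear
  subspace, where it agrees with smoothness in linear coordinates of the subspace.\<close>

definition smooth_on :: "'e::real_normed_vector set \<Rightarrow> ('e \<Rightarrow> 'f::real_normed_vector) \<Rightarrow> bool" where
  "smooth_on S f \<longleftrightarrow>
     (\<forall>x\<in>S. \<exists>W g. open W \<and> x \<in> W \<and> (\<forall>k. Ck_on k W g) \<and> (\<forall>y\<in>S \<inter> W. g y = f y))"

text \<open>The model space \<open>\<real>\<^sup>n\<close> of a manifold of dimension \<open>n\<close> is represented by an \<open>n\<close>-dimensional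
  linear subspace \<open>V\<close> of some \<open>real^'m\<close>. The choice \<open>V = UNIV\<close> is the usual one; proper
  subspaces are allowed so that \<open>n\<close> is an arbitrary natural number, zero included.
  A chart is a pair of a domain \<open>U\<close> and a coordinate map \<open>\<phi>\<close>, whose values outside \<open>U\<close> are
  irrelevant.\<close>

definition smooth_atlas ::
  "(real^'m) set \<Rightarrow> 'a topology \<Rightarrow> ('a set \<times> ('a \<Rightarrow> real^'m)) set \<Rightarrow> bool" where
  "smooth_atlas V X A \<longleftrightarrow>
     (\<forall>(U, \<phi>)\<in>A. openin X U \<and> openin (top_of_set V) (\<phi> ` U) \<and>
        homeomorphic_map (subtopology X U) (top_of_set (\<phi> ` U)) \<phi>) \<and>
     (\<Union>(U, \<phi>)\<in>A. U) = topspace X \<and>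
     (\<forall>(U, \<phi>)\<in>A. \<forall>(U', \<psi>)\<in>A. smooth_on (\<phi> ` (U \<inter> U')) (\<lambda>x. \<psi> (inv_into U \<phi> x)))"

definition smooth_manifold ::
  "nat \<Rightarrow> (real^'m) set \<Rightarrow> 'a topology \<Rightarrow> ('a set \<times> ('a \<Rightarrow> real^'m)) set \<Rightarrow> bool" where
  "smooth_manifold n V X A \<longleftrightarrow>
     subspace V \<and> dim V = n \<and>
     Hausdorff_space X \<and> second_countable X \<and> smooth_atlas V X A"

text \<open>\<open>\<complex>\<^sup>N\<close> as the space of complex sequences vanishing from index \<open>N\<close> on.\<close>

definition complex_space :: "nat \<Rightarrow> (nat \<Rightarrow> complex) set" where
  "complex_space N = {z. \<forall>i\<ge>N. z i = 0}"

definition smooth_map_to_complex_space ::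
  "'a topology \<Rightarrow> ('a set \<times> ('a \<Rightarrow> real^'m)) set \<Rightarrow> nat \<Rightarrow> ('a \<Rightarrow> nat \<Rightarrow> complex) \<Rightarrow> bool" where
  "smooth_map_to_complex_space X A N f \<longleftrightarrow>
     f ` topspace X \<subseteq> complex_space N \<and>
     (\<forall>(U, \<phi>)\<in>A. \<forall>i<N. smooth_on (\<phi> ` U) (\<lambda>x. f (inv_into U \<phi> x) i))"

text \<open>The differential of \<open>f\<close> at \<open>p\<close> read in the chart \<open>(U, \<phi>)\<close>, which identifies \<open>T\<^sub>pM\<close> with \<open>V\<close>.
  Since \<open>\<phi> ` U\<close> is only relatively open in \<open>V\<close>, the derivative is taken within \<open>V\<close>; it is
  therefore determined (and used) for \<open>v \<in> V\<close> only.\<close>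

definition differential_in_chart ::
  "(real^'m) set \<Rightarrow> 'a set \<times> ('a \<Rightarrow> real^'m) \<Rightarrow> ('a \<Rightarrow> nat \<Rightarrow> complex) \<Rightarrow> 'a \<Rightarrow> real^'m \<Rightarrow> (nat \<Rightarrow> complex)"
  where
  "differential_in_chart V c f p v =
     (\<lambda>i. frechet_derivative (\<lambda>x. f (inv_into (fst c) (snd c) x) i) (at (snd c p) within V) v)"

definition smooth_immersion ::
  "(real^'m) set \<Rightarrow> 'a topology \<Rightarrow> ('a set \<times> ('a \<Rightarrow> real^'m)) set \<Rightarrow> nat \<Rightarrow> ('a \<Rightarrow> nat \<Rightarrow> complex) \<Rightarrow> bool"
  where
  "smooth_immersion V X A N f \<longleftrightarrow>
     smooth_map_to_complex_space X A N f \<and>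
     (\<forall>c\<in>A. \<forall>p\<in>fst c. inj_on (differential_in_chart V c f p) V)"

definition totally_real_immersion ::
  "(real^'m) set \<Rightarrow> 'a topology \<Rightarrow> ('a set \<times> ('a \<Rightarrow> real^'m)) set \<Rightarrow> nat \<Rightarrow> ('a \<Rightarrow> nat \<Rightarrow> complex) \<Rightarrow> bool"
  where
  "totally_real_immersion V X A N f \<longleftrightarrow>
     smooth_immersion V X A N f \<and>
     (\<forall>c\<in>A. \<forall>p\<in>fst c. let T = differential_in_chart V c f p ` V in
        T \<inter> (\<lambda>z i. \<i> * z i) ` T = {\<lambda>i. 0})"

end

theory Submission
  imports Defs
begin

text \<open>Injective complex-linear maps \<open>\<complex>\<^sup>n \<rightarrow> \<complex>\<^sup>N\<close> have a complement of real codimension \<open>2 (N - n + 1)\<close>, which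
  exceeds \<open>n\<close> exactly when \<open>N \<ge> [3n/2]\<close>. Hence the complexified differential of a generic smooth map
  \<open>M \<rightarrow> \<complex>\<^sup>N\<close> is injective everywhere, and such a map is a totally real immersion. Concretely, start with
  the zero map and add, in one chart after another, a small generic linear map times a cutoff function:
  where the cutoff is constant the bad linear maps form a set of measure zero, and a small perturbation
  does not destroy what was achieved on a compact set before. Along an exhaustion by compact sets the
  corrections can be supported away from the earlier sets, so the process stabilises locally.\<close>

section \<open>Smooth functions and cutoffs\<close>

text \<open>Suppose the complexified differential kills u + i v, so df(u) = - i df(v). Either both
  sides vanish and df is not injective unless u = v = 0, or df(u) is a nonzero vector lying both in
  the image of df and in i times that image. Hence one injectivity condition covers immersion and
  total reality together. Two encodings shape the proof. Charts take values in a subspace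
  \<open>V\<close> that may have empty interior, so functions are composed with a linear projection
  onto \<open>V\<close> and differentiated on open sets. The number \<open>N\<close> is not a type,
  so maps take values in a subspace \<open>Y = R \<times> R\<close> of a fixed Euclidean space, with
  \<open>dim R = [3n/2]\<close>, and complex coordinates return only at the end. In real dimensions
  the bound on \<open>N\<close> becomes \<open>3 * dim V \<le> dim Y + 1\<close>. The measure-zero
  statement uses only that differentiable images of sets of lower dimension are null; no form of
  Sard's theorem enters.\<close>

lemma Ck_on_mono: "Ck_on k W f \<Longrightarrow> W' \<subseteq> W \<Longrightarrow> Ck_on k W' f"
  by (induction k arbitrary: f) (auto intro: continuous_on_subset)

lemma frechet_derivative_cong_open:
  assumes "open W" "x \<in> W" "\<And>y. y \<in> W \<Longrightarrow> f y = g y"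
  shows "frechet_derivative f (at x) = frechet_derivative g (at x)"
proof -
  have "(f has_derivative D) (at x) \<longleftrightarrow> (g has_derivative D) (at x)" for D
    using assms has_derivative_transform_within_open[of f D x UNIV W g]
      has_derivative_transform_within_open[of g D x UNIV W f] by auto
  then show ?thesis unfolding frechet_derivative_def by simp
qed

lemma differentiable_cong_open:
  assumes "f differentiable (at x)" "open W" "x \<in> W" "\<And>y. y \<in> W \<Longrightarrow> f y = g y"
  shows "g differentiable (at x)"
  using assms has_derivative_transform_within_open[of f _ x UNIV W g]
  unfolding differentiable_def by blast

lemma Ck_on_cong:
  assumes "open W" "\<And>y. y \<in> W \<Longrightarrow> f y = g y" "Ck_on k W f"
  shows "Ck_on k W g"
  using assms(2,3)
proof (induction k arbitrary: f g)
  case 0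
  then show ?case using continuous_on_cong[of W W f g] by simp
next
  case (Suc k)
  have "frechet_derivative f (at x) v = frechet_derivative g (at x) v" if "x \<in> W" for x v
    using frechet_derivative_cong_open[OF assms(1) that] Suc.prems(1) by metis
  then have "Ck_on k W (\<lambda>x. frechet_derivative g (at x) v)" for v
    using Suc.IH[of "\<lambda>x. frechet_derivative f (at x) v" "\<lambda>x. frechet_derivative g (at x) v"] Suc.prems
    by simp
  moreover have "g differentiable (at x)" if "x \<in> W" for x
    using differentiable_cong_open[of f x W g] Suc.prems that assms(1) by simp
  ultimately show ?case by simp
qed

lemma Ck_on_Suc_imp: "Ck_on (Suc k) W f \<Longrightarrow> Ck_on k W f"
proof (induction k arbitrary: f)
  case 0
  then show ?case
    by (auto intro!: continuous_at_imp_continuous_on differentiable_imp_continuous_within)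
next
  case (Suc k)
  then show ?case by simp
qed

lemma Ck_on_local:
  assumes "\<And>x. x \<in> W \<Longrightarrow> \<exists>W'. open W' \<and> x \<in> W' \<and> Ck_on k W' f"
  shows "Ck_on k W f"
  using assms
proof (induction k arbitrary: f)
  case 0
  then show ?case
    by (metis Ck_on.simps(1) continuous_at_imp_continuous_on continuous_on_eq_continuous_at)
next
  case (Suc k)
  have "f differentiable (at x)" if "x \<in> W" for x
    using Suc.prems[OF that] by auto
  moreover have "Ck_on k W (\<lambda>x. frechet_derivative f (at x) v)" for v
    by (rule Suc.IH) (use Suc.prems in fastforce)
  ultimately show ?case by simp
qed

section \<open>Closure properties of \<open>Ck_on\<close>\<close>

lemma Ck_on_const [simp]: "Ck_on k W (\<lambda>x. c)"
  by (induction k arbitrary: c) (auto simp: frechet_derivative_const)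

lemma Ck_on_bounded_linear:
  assumes "bounded_linear L"
  shows "Ck_on k W L"
proof (cases k)
  case 0
  then show ?thesis using assms by (simp add: linear_continuous_on)
next
  case (Suc l)
  have "frechet_derivative L (at x) = L" for x
    using frechet_derivative_at[OF bounded_linear_imp_has_derivative[OF assms, of "at x"]] by simp
  then show ?thesis
    using Suc assms by (simp add: bounded_linear_imp_differentiable)
qed

lemma frechet_derivative_eq: "(f has_derivative D) (at x) \<Longrightarrow> frechet_derivative f (at x) = D"
  using frechet_derivative_at by metis

lemma has_frechet_derivative:
  "f differentiable (at x) \<Longrightarrow> (f has_derivative frechet_derivative f (at x)) (at x)"
  by (simp add: frechet_derivative_works)

lemma Ck_on_linear_compose:
  assumes "bounded_linear L" "open W" "Ck_on k W f"
  shows "Ck_on k W (\<lambda>x. L (f x))"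
  using assms(3)
proof (induction k arbitrary: f)
  case 0
  then show ?case by (simp add: bounded_linear.continuous_on[OF assms(1)])
next
  case (Suc k)
  have D: "((\<lambda>x. L (f x)) has_derivative (\<lambda>v. L (frechet_derivative f (at x) v))) (at x)" if "x \<in> W" for x
    using Suc.prems that
    by (auto intro!: bounded_linear.has_derivative[OF assms(1)] has_frechet_derivative)
  have "Ck_on k W (\<lambda>x. frechet_derivative (\<lambda>x. L (f x)) (at x) v)" for v
    by (rule Ck_on_cong[OF assms(2), of "\<lambda>x. L (frechet_derivative f (at x) v)"])
       (use Suc frechet_derivative_eq[OF D] in auto)
  with D show ?case by (auto simp: differentiable_def)
qed

lemma Ck_on_add:
  assumes "open W" "Ck_on k W f" "Ck_on k W g"
  shows "Ck_on k W (\<lambda>x. f x + g x)"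
  using assms(2,3)
proof (induction k arbitrary: f g)
  case 0
  then show ?case by (simp add: continuous_on_add)
next
  case (Suc k)
  have D: "((\<lambda>x. f x + g x) has_derivative
      (\<lambda>v. frechet_derivative f (at x) v + frechet_derivative g (at x) v)) (at x)" if "x \<in> W" for x
    using Suc.prems that by (auto intro!: has_derivative_add has_frechet_derivative)
  have "Ck_on k W (\<lambda>x. frechet_derivative (\<lambda>x. f x + g x) (at x) v)" for v
    by (rule Ck_on_cong[OF assms(1), of "\<lambda>x. frechet_derivative f (at x) v + frechet_derivative g (at x) v"])
       (use Suc frechet_derivative_eq[OF D] in auto)
  with D show ?case by (auto simp: differentiable_def)
qed

lemma Ck_on_sum:
  assumes "open W" "finite I" "\<And>i. i \<in> I \<Longrightarrow> Ck_on k W (f i)"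
  shows "Ck_on k W (\<lambda>x. \<Sum>i\<in>I. f i x)"
  using assms(2,3) by induction (auto intro: Ck_on_add assms(1))

lemma Ck_on_scaleR:
  assumes "open W" "Ck_on k W f" "Ck_on k W g"
  shows "Ck_on k W (\<lambda>x. f x *\<^sub>R g x)"
  using assms(2,3)
proof (induction k arbitrary: f g)
  case 0
  then show ?case by (simp add: continuous_on_scaleR)
next
  case (Suc k)
  let ?D = "\<lambda>x v. f x *\<^sub>R frechet_derivative g (at x) v + frechet_derivative f (at x) v *\<^sub>R g x"
  have D: "((\<lambda>x. f x *\<^sub>R g x) has_derivative ?D x) (at x)" if "x \<in> W" for x
    using Suc.prems that by (auto intro!: has_derivative_scaleR has_frechet_derivative)
  have "Ck_on k W f" "Ck_on k W g"
    using Suc.prems[THEN Ck_on_Suc_imp] by simp_all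
  moreover have "Ck_on k W (\<lambda>x. frechet_derivative f (at x) v)"
    "Ck_on k W (\<lambda>x. frechet_derivative g (at x) v)" for v
    using Suc.prems by simp_all
  ultimately have "Ck_on k W (\<lambda>x. ?D x v)" for v
    by (intro Ck_on_add assms(1) Suc.IH)
  then have "Ck_on k W (\<lambda>x. frechet_derivative (\<lambda>x. f x *\<^sub>R g x) (at x) v)" for v
    by (rule Ck_on_cong[OF assms(1), rotated]) (simp add: frechet_derivative_eq[OF D])
  with D show ?case by (auto simp: differentiable_def)
qed

lemma linear_euclidean_expansion:
  fixes L :: "'a::euclidean_space \<Rightarrow> 'b::real_vector"
  assumes "linear L"
  shows "L v = (\<Sum>b\<in>Basis. (v \<bullet> b) *\<^sub>R L b)"
proof -
  have "L v = L (\<Sum>b\<in>Basis. (v \<bullet> b) *\<^sub>R b)"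
    by (simp add: euclidean_representation)
  also have "\<dots> = (\<Sum>b\<in>Basis. (v \<bullet> b) *\<^sub>R L b)"
    by (simp only: linear_sum[OF assms] linear_scale[OF assms])
  finally show ?thesis .
qed

lemma Ck_on_compose:
  fixes g :: "'e::real_normed_vector \<Rightarrow> 'f::euclidean_space"
  assumes "open W" "open W'" "Ck_on k W g" "Ck_on k W' f" "\<And>x. x \<in> W \<Longrightarrow> g x \<in> W'"
  shows "Ck_on k W (\<lambda>x. f (g x))"
  using assms(3,4)
proof (induction k arbitrary: f)
  case 0
  then show ?case using assms(5) by (auto intro: continuous_on_compose2)
next
  case (Suc k)
  let ?D = "\<lambda>x v. frechet_derivative f (at (g x)) (frechet_derivative g (at x) v)"
  have D: "((\<lambda>x. f (g x)) has_derivative ?D x) (at x)" if "x \<in> W" for x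
    using Suc.prems that assms(5)
    by (auto intro!: has_derivative_compose[of g] has_frechet_derivative)
  have lin: "linear (frechet_derivative f (at (g x)))" if "x \<in> W" for x
    using Suc.prems that assms(5) by (auto intro: linear_frechet_derivative)
  \<comment> \<open>The derivative of \<open>f\<close> is evaluated at a vector that varies with
    \<open>x\<close>, whereas \<open>Ck_on\<close> controls it only on fixed vectors. Expanding in a
    basis of the middle space separates the two dependences.\<close>
  have eq: "?D x v = (\<Sum>b\<in>Basis. (frechet_derivative g (at x) v \<bullet> b) *\<^sub>R frechet_derivative f (at (g x)) b)"
    if "x \<in> W" for x v
    using linear_euclidean_expansion[OF lin[OF that]] .
  have "Ck_on k W g"
    using Suc.prems(1)[THEN Ck_on_Suc_imp] .
  then have "Ck_on k W (\<lambda>x. \<Sum>b\<in>Basis. (frechet_derivative g (at x) v \<bullet> b) *\<^sub>R frechet_derivative f (at (g x)) b)" for v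
    using Suc.prems
    by (intro Ck_on_sum Ck_on_scaleR assms(1) Ck_on_linear_compose[OF bounded_linear_inner_left]) (auto intro!: Suc.IH)
  then have "Ck_on k W (\<lambda>x. frechet_derivative (\<lambda>x. f (g x)) (at x) v)" for v
    by (rule Ck_on_cong[OF assms(1), rotated])
       (use frechet_derivative_eq[OF D] eq in auto)
  with D show ?case by (auto simp: differentiable_def)
qed

lemma Ck_on_inverse: "Ck_on k {0::real<..} inverse"
proof (induction k)
  case 0
  show ?case by (auto intro!: continuous_intros)
next
  case (Suc k)
  have D: "(inverse has_derivative (\<lambda>h. (inverse x * inverse x) *\<^sub>R (- h))) (at x)" if "x > 0" for x :: real
    using that by (auto intro!: derivative_eq_intros simp: algebra_simps)
  have "Ck_on k {0::real<..} (\<lambda>x. (inverse x *\<^sub>R inverse x) *\<^sub>R (- v))" for v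
    by (intro Ck_on_scaleR Suc) auto
  then have "Ck_on k {0::real<..} (\<lambda>x. frechet_derivative inverse (at x) v)" for v
    by (rule Ck_on_cong[rotated 2])
       (use frechet_derivative_eq[OF D] in auto)
  with D show ?case by (auto simp: differentiable_def)
qed

text \<open>The functions \<open>p (1/x) exp (-1/x)\<close> with a polynomial \<open>p\<close>, extended by zero, form a family that is
  closed under differentiation; this gives smoothness at the origin.\<close>

definition flat_exp :: "real poly \<Rightarrow> real \<Rightarrow> real" where
  "flat_exp p x = (if x > 0 then poly p (inverse x) * exp (- inverse x) else 0)"

lemma poly_exp_minus_tendsto_0: "((\<lambda>y. poly p y * exp (- y)) \<longlongrightarrow> 0) (at_top :: real filter)"
proof -
  have "((\<lambda>y. \<Sum>i\<le>degree p. coeff p i * (y ^ i / exp y)) \<longlongrightarrow> (\<Sum>i\<le>degree p. coeff p i * 0)) (at_top :: real filter)"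
    by (intro tendsto_intros tendsto_power_div_exp_0)
  moreover have "(\<Sum>i\<le>degree p. coeff p i * (y ^ i / exp y)) = poly p y * exp (- y)" for y :: real
    by (simp add: poly_altdef sum_distrib_right exp_minus divide_inverse mult.assoc)
  ultimately show ?thesis by simp
qed

text \<open>With y = 1/x the chain rule gives dy/dx = - y^2, so p(y) exp(-y) has derivative y^2
  (p(y) - p'(y)) exp(-y). This is where the factor \<open>[:0,0,1:]\<close> comes from.\<close>

lemma flat_exp_has_derivative:
  "(flat_exp p has_field_derivative flat_exp ([:0,0,1:] * (p - pderiv p)) x) (at x)"
proof -
  consider "x < 0" | "x = 0" | "x > 0" by linarith
  then show ?thesis
  proof cases
    case 1
    have "((\<lambda>x. 0) has_field_derivative 0) (at x)" by simp
    then have "(flat_exp p has_field_derivative 0) (at x)"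
      by (rule DERIV_cong_ev[THEN iffD1, rotated 3])
         (use 1 eventually_nhds_in_open[of "{..<0}" x] in \<open>auto simp: flat_exp_def elim!: eventually_mono\<close>)
    then show ?thesis using 1 by (simp add: flat_exp_def)
  next
    case 2
    \<comment> \<open>The right difference quotient at 0 is y p(y) exp(-y) with y = 1/h; division by
      h supplies the extra factor y.\<close>
    have "((\<lambda>y. poly ([:0,1:] * p) y * exp (- y)) \<longlongrightarrow> 0) (at_top :: real filter)"
      by (rule poly_exp_minus_tendsto_0)
    then have "((\<lambda>h. poly ([:0,1:] * p) (inverse h) * exp (- inverse h)) \<longlongrightarrow> 0) (at_right 0)"
      by (rule filterlim_compose) (rule filterlim_inverse_at_top_right)
    then have "((\<lambda>h. (flat_exp p (0 + h) - flat_exp p 0) / h) \<longlongrightarrow> 0) (at_right 0)"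
      by (rule Lim_transform_eventually)
         (auto simp: eventually_at_right_field flat_exp_def field_simps intro!: exI[of _ 1])
    moreover have "((\<lambda>h. (flat_exp p (0 + h) - flat_exp p 0) / h) \<longlongrightarrow> 0) (at_left 0)"
      by (rule Lim_transform_eventually[OF tendsto_const])
         (auto simp: eventually_at_left_field flat_exp_def intro!: exI[of _ "-1"])
    ultimately have "((\<lambda>h. (flat_exp p (0 + h) - flat_exp p 0) / h) \<longlongrightarrow> 0) (at 0)"
      by (simp add: filterlim_split_at)
    then show ?thesis using 2 by (simp add: DERIV_def flat_exp_def)
  next
    case 3
    have "((\<lambda>x. poly p (inverse x) * exp (- inverse x)) has_field_derivative
        flat_exp ([:0,0,1:] * (p - pderiv p)) x) (at x)"
      using 3 by (auto intro!: derivative_eq_intros simp: flat_exp_def algebra_simps power2_eq_square)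
    then show ?thesis
      by (rule DERIV_cong_ev[THEN iffD1, rotated 3])
         (use 3 eventually_nhds_in_open[of "{0<..}" x] in \<open>auto simp: flat_exp_def elim!: eventually_mono\<close>)
  qed
qed

lemma Ck_on_flat_exp: "Ck_on k UNIV (flat_exp p)"
proof (induction k arbitrary: p)
  case 0
  show ?case
    using DERIV_isCont[OF flat_exp_has_derivative]
    by (auto intro: continuous_at_imp_continuous_on)
next
  case (Suc k)
  have D: "(flat_exp p has_derivative (\<lambda>v. flat_exp ([:0,0,1:] * (p - pderiv p)) x *\<^sub>R v)) (at x)" for x
    using flat_exp_has_derivative[of p x] by (simp add: has_field_derivative_def)
  have "Ck_on k UNIV (\<lambda>x. flat_exp ([:0,0,1:] * (p - pderiv p)) x *\<^sub>R v)" for v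
    by (intro Ck_on_scaleR Suc) auto
  then have "Ck_on k UNIV (\<lambda>x. frechet_derivative (flat_exp p) (at x) v)" for v
    by (simp only: frechet_derivative_eq[OF D])
  moreover have "flat_exp p differentiable (at x)" for x
    unfolding differentiable_def by (rule exI, rule D)
  ultimately show ?case by simp
qed

text \<open>The usual quotient f / (f + g): \<open>f\<close> is positive exactly inside radius 2r
  and \<open>g\<close> exactly outside radius r, so the denominator never vanishes. The squared
  distance \<open>s\<close> is used because, unlike the distance, it is smooth at the
  centre.\<close>

lemma smooth_cutoff_exists:
  fixes z :: "'e::euclidean_space"
  assumes "r > 0"
  obtains b :: "'e \<Rightarrow> real"
  where "\<And>k. Ck_on k UNIV b" "\<And>x. x \<in> ball z r \<Longrightarrow> b x = 1" "\<And>x. x \<notin> cball z (2 * r) \<Longrightarrow> b x = 0"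
proof -
  define s where "s x = (x - z) \<bullet> (x - z)" for x :: 'e
  define f where "f x = flat_exp 1 (4 * r\<^sup>2 - s x)" for x
  define g where "g x = flat_exp 1 (s x - r\<^sup>2)" for x
  have s: "s x = (dist z x)\<^sup>2" for x
    by (simp add: s_def dist_norm norm_minus_commute power2_norm_eq_inner)
  have id: "Ck_on k UNIV (\<lambda>x::'e. x - z)" for k
    using Ck_on_add[OF open_UNIV Ck_on_bounded_linear[OF bounded_linear_ident] Ck_on_const[of k UNIV "-z"]] by simp
  have seq: "s x = (\<Sum>b\<in>Basis. ((x - z) \<bullet> b) *\<^sub>R ((x - z) \<bullet> b))" for x
    unfolding s_def by (subst euclidean_inner) simp
  have sm: "Ck_on k UNIV s" for k
    unfolding seq[abs_def]
    by (intro Ck_on_sum Ck_on_scaleR Ck_on_linear_compose[OF bounded_linear_inner_left] id) auto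
  have sf: "Ck_on k UNIV f" for k
    unfolding f_def
    by (rule Ck_on_compose[OF _ _ _ Ck_on_flat_exp])
       (use Ck_on_add[OF open_UNIV Ck_on_const[of k UNIV "4 * r\<^sup>2"]
          Ck_on_linear_compose[OF bounded_linear_minus[OF bounded_linear_ident] open_UNIV sm[of k]]] in auto)
  have sg: "Ck_on k UNIV g" for k
    unfolding g_def
    by (rule Ck_on_compose[OF _ _ _ Ck_on_flat_exp])
       (use Ck_on_add[OF open_UNIV sm[of k] Ck_on_const[of k UNIV "- r\<^sup>2"]] in auto)
  have pos: "f x + g x > 0" for x
  proof -
    have "4 * r\<^sup>2 - s x > 0 \<or> s x - r\<^sup>2 > 0"
      using assms by (smt (verit) zero_less_power)
    then show ?thesis by (auto simp: f_def g_def flat_exp_def add_pos_pos)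
  qed
  show ?thesis
  proof
    show "Ck_on k UNIV (\<lambda>x. f x *\<^sub>R inverse (f x + g x))" for k
      by (intro Ck_on_scaleR sf Ck_on_compose[OF _ _ _ Ck_on_inverse] Ck_on_add sg) (auto simp: pos)
    show "f x *\<^sub>R inverse (f x + g x) = 1" if "x \<in> ball z r" for x
    proof -
      have "s x \<le> r\<^sup>2" using that by (simp add: s power_mono)
      then have "g x = 0" by (simp add: g_def flat_exp_def)
      then show ?thesis using pos[of x] by simp
    qed
    show "f x *\<^sub>R inverse (f x + g x) = 0" if "x \<notin> cball z (2 * r)" for x
    proof -
      have "(2 * r)\<^sup>2 \<le> s x"
        unfolding s using that assms by (intro power_mono) auto
      then have "f x = 0" by (simp add: f_def flat_exp_def power_mult_distrib)
      then show ?thesis by simp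
    qed
  qed
qed

section \<open>General position\<close>

lemma linear_projection_exists:
  fixes V :: "'a::euclidean_space set"
  assumes "subspace V"
  obtains \<pi> :: "'a \<Rightarrow> 'a" where "linear \<pi>" "\<And>x. \<pi> x \<in> V" "\<And>x. x \<in> V \<Longrightarrow> \<pi> x = x"
proof -
  have "\<exists>g. range g \<subseteq> V \<and> linear g \<and> (\<forall>v\<in>V. g (id v) = v)"
    by (rule linear_exists_left_inverse_on) (use assms in \<open>auto simp: linear_ident\<close>)
  then show ?thesis using that by auto
qed

text \<open>Since the dimension of the target is not a type, negligibility inside the subspace \<open>Q\<close> is
  expressed by taking preimages under a projection onto \<open>Q\<close>.\<close>

lemma negligible_vimage_lowdim_image:
  fixes F :: "'a::euclidean_space \<Rightarrow> 'b::euclidean_space"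
  assumes P: "subspace P" and Q: "subspace Q" and dim: "dim P < dim Q"
    and S: "S \<subseteq> P" and F: "F differentiable_on S"
    and \<pi>: "linear \<pi>" "\<And>x. \<pi> x \<in> Q" "\<And>x. x \<in> Q \<Longrightarrow> \<pi> x = x"
  shows "negligible {z. \<pi> z \<in> F ` S}"
proof -
  \<comment> \<open>\<open>H\<close> is a copy of \<open>P\<close> inside \<open>Q\<close>. Its
    preimage \<open>Z\<close> under the projection is a proper subspace of the whole space, hence
    null.\<close>
  obtain H where H: "subspace H" "H \<subseteq> Q" "dim H = dim P"
    using choose_subspace_of_subspace[of "dim P" Q] dim Q span_eq_iff[of Q] by (metis less_imp_le)
  obtain L where L: "linear L" "L ` H = P"
    using isometries_subspaces[OF H(1) P H(3)] by metis
  define Z where "Z = {z. \<pi> z \<in> H}"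
  have subZ: "subspace Z"
    unfolding Z_def using linear_subspace_vimage[OF \<pi>(1) H(1)] by (simp add: vimage_def)
  have "Z \<noteq> UNIV"
  proof
    assume "Z = UNIV"
    then have "\<pi> x \<in> H" for x by (auto simp: Z_def)
    then have "Q \<subseteq> H" using \<pi>(3) by (metis subsetI)
    then show False using H dim by (metis less_irrefl subset_antisym)
  qed
  then have "dim Z < DIM('b)"
    using subZ by (metis dim_eq_full dim_subset_UNIV le_neq_implies_less span_eq_iff)
  then have negZ: "negligible Z" by (rule negligible_lowdim)
  define T where "T = {z \<in> Z. L (\<pi> z) \<in> S}"
  \<comment> \<open>Differentiable maps preserve null sets when source and target have equal
    dimension. \<open>G\<close> is therefore defined on the whole target space: it acts as
    \<open>F\<close> after \<open>L\<close> on the component in \<open>Q\<close> and leaves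
    \<open>z - \<pi> z\<close> fixed.\<close>
  define G where "G z = \<pi> (F (L (\<pi> z))) + (z - \<pi> z)" for z
  have b\<pi>: "\<pi> differentiable_on A" for A
    using \<pi>(1) by (simp add: linear_imp_differentiable_on)
  have "(\<lambda>z. L (\<pi> z)) differentiable_on T"
    using linear_compose[OF \<pi>(1) L(1)] by (simp add: o_def linear_imp_differentiable_on)
  moreover have "F differentiable_on (\<lambda>z. L (\<pi> z)) ` T"
    by (rule differentiable_on_subset[OF F]) (auto simp: T_def)
  ultimately have "(\<lambda>z. F (L (\<pi> z))) differentiable_on T"
    using differentiable_on_compose by blast
  then have "(\<lambda>z. \<pi> (F (L (\<pi> z)))) differentiable_on T"
    using differentiable_on_compose[of "\<lambda>z. F (L (\<pi> z))" T \<pi>] b\<pi> by blast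
  then have "G differentiable_on T"
    unfolding G_def using b\<pi> by (auto intro!: differentiable_on_add differentiable_on_diff)
  then have "negligible (G ` T)"
    by (rule negligible_differentiable_image_negligible[OF order_refl, rotated])
       (rule negligible_subset[OF negZ], auto simp: T_def)
  moreover have "{z. \<pi> z \<in> F ` S} \<subseteq> G ` T"
  proof safe
    fix z s assume s: "s \<in> S" "\<pi> z = F s"
    then obtain h where h: "h \<in> H" "L h = s" using S L(2) by blast
    define z' where "z' = h + (z - \<pi> z)"
    have "\<pi> z' = h"
      using h H(2) \<pi> by (auto simp: z'_def linear_add linear_diff)
    moreover have "\<pi> (F s) = F s" using s(2)[symmetric] \<pi>(2,3) by metis
    ultimately show "z \<in> G ` T"
      using h s by (intro image_eqI[of _ _ z']) (auto simp: G_def T_def Z_def z'_def)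
  qed
  ultimately show ?thesis by (rule negligible_subset)
qed

text \<open>Multiplication by the imaginary unit when \<open>\<complex>\<^sup>N\<close> is viewed as a product of real and imaginary parts.\<close>

definition mult_i :: "'r \<times> 'r \<Rightarrow> 'r \<times> 'r::real_normed_vector" where
  "mult_i z = (- snd z, fst z)"

lemma bounded_linear_mult_i: "bounded_linear (mult_i :: 'r::real_normed_vector \<times> 'r \<Rightarrow> _)"
  unfolding mult_i_def
  by (intro bounded_linear_Pair bounded_linear_minus bounded_linear_fst bounded_linear_snd)

lemmas linear_mult_i = bounded_linear.linear[OF bounded_linear_mult_i]

lemma mult_i_mult_i [simp]: "mult_i (mult_i z) = - z"
  by (simp add: mult_i_def prod_eq_iff)

lemma dim_slice_less:
  fixes V :: "(real^'m) set"
  assumes "subspace V" "w \<in> V" "w $ l \<noteq> 0"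
  shows "subspace {u \<in> V. u $ l = 0}" "dim {u \<in> V. u $ l = 0} < dim V"
proof -
  show sub: "subspace {u \<in> V. u $ l = 0}"
    using assms(1) by (auto simp: subspace_def)
  have "{u \<in> V. u $ l = 0} \<subset> V"
    using assms by auto
  then show "dim {u \<in> V. u $ l = 0} < dim V"
    using dim_psubset sub assms(1) by (metis span_eq_iff)
qed

text \<open>The copy of \<open>Y\<close> placed in coordinate \<open>l\<close> meets the slice only
  in 0, so fixing that coordinate frees \<open>dim Y\<close> dimensions. This is the gain that pays
  for the parameters in the general position count.\<close>

lemma dim_vec_slice:
  fixes Y :: "'w::euclidean_space set" and l :: "'m::finite"
  assumes "subspace Y"
  shows "subspace {a::'w^'m. (\<forall>k. a $ k \<in> Y)}"
    "subspace {a::'w^'m. (\<forall>k. a $ k \<in> Y) \<and> a $ l = 0}"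
    "dim {a::'w^'m. (\<forall>k. a $ k \<in> Y) \<and> a $ l = 0} + dim Y \<le> dim {a::'w^'m. \<forall>k. a $ k \<in> Y}"
proof -
  let ?Q = "{a::'w^'m. \<forall>k. a $ k \<in> Y}" and ?S = "{a::'w^'m. (\<forall>k. a $ k \<in> Y) \<and> a $ l = 0}"
  show subQ: "subspace ?Q" and subS: "subspace ?S"
    using assms by (auto simp: subspace_def)
  have lin: "linear (axis l :: 'w \<Rightarrow> 'w^'m)"
    by (auto simp: linear_iff axis_def vec_eq_iff)
  have inj: "inj (axis l :: 'w \<Rightarrow> 'w^'m)"
    by (auto simp: inj_def axis_eq_axis)
  have subT: "subspace (axis l ` Y)"
    using lin assms by (rule linear_subspace_image)
  have dT: "dim ((axis l :: 'w \<Rightarrow> 'w^'m) ` Y) = dim Y"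
    using lin inj by (intro dim_image_eq) (auto intro: inj_on_subset)
  have "?S \<inter> axis l ` Y \<subseteq> {0}"
    by (auto simp: axis_def vec_eq_iff)
  then have d0: "dim (?S \<inter> axis l ` Y) = 0"
    using dim_eq_0 by blast
  have "{x + y |x y. x \<in> ?S \<and> y \<in> axis l ` Y} \<subseteq> ?Q"
    using assms by (auto simp: axis_def subspace_add subspace_0)
  then have "dim {x + y |x y. x \<in> ?S \<and> y \<in> axis l ` Y} \<le> dim ?Q"
    by (rule dim_subset)
  then show "dim ?S + dim Y \<le> dim ?Q"
    using dim_sums_Int[OF subS subT] dT d0 by linarith
qed


text \<open>If the complexified derivative of \<open>h + (\<Sum>k. x\<^sub>k a\<^sub>k)\<close>, where \<open>h\<close> has derivative \<open>D\<close>, kills a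
  vector \<open>u + i v \<noteq> 0\<close>, then some coordinate \<open>l\<close> of that vector can be normalised to \<open>1\<close>, and the equation
  determines \<open>a\<^sub>l\<close> from \<open>x\<close>, \<open>u\<close>, \<open>v\<close> and the other \<open>a\<^sub>k\<close>. With \<open>n = dim V\<close> these are at most
  \<open>n + 2 (n - 1)\<close> new parameters in exchange for the \<open>dim Y\<close> parameters of \<open>a\<^sub>l\<close>.\<close>

lemma generic_perturbation_exists:
  fixes V :: "(real^'m) set" and Y :: "('r::euclidean_space \<times> 'r) set"
    and D :: "real^'m \<Rightarrow> real^'m \<Rightarrow> 'r \<times> 'r"
  assumes V: "subspace V" and Y: "subspace Y" and dim: "3 * dim V \<le> dim Y + 1"
    and D: "\<And>x. x \<in> \<Omega> \<Longrightarrow> linear (D x)" "\<And>x b. x \<in> \<Omega> \<Longrightarrow> (\<lambda>x. D x b) differentiable (at x)"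
    and \<epsilon>: "\<epsilon> > 0"
  obtains a :: "('r \<times> 'r)^'m" where "norm a < \<epsilon>" "\<And>k. a $ k \<in> Y"
    "\<And>x u v. x \<in> V \<inter> \<Omega> \<Longrightarrow> u \<in> V \<Longrightarrow> v \<in> V \<Longrightarrow>
       D x u + (\<Sum>k\<in>UNIV. u $ k *\<^sub>R a $ k) + mult_i (D x v + (\<Sum>k\<in>UNIV. v $ k *\<^sub>R a $ k)) = 0 \<Longrightarrow>
       u = 0 \<and> v = 0"
proof -
  define Q where "Q = {a::('r \<times> 'r)^'m. \<forall>k. a $ k \<in> Y}"
  define Qs where "Qs l = {a::('r \<times> 'r)^'m. (\<forall>k. a $ k \<in> Y) \<and> a $ l = 0}" for l
  define Vs where "Vs l = {u \<in> V. u $ l = 0}" for l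
  have Q: "subspace Q" "subspace (Qs l)" "dim (Qs l) + dim Y \<le> dim Q" for l
    unfolding Q_def Qs_def using dim_vec_slice[OF Y] by auto
  obtain \<pi> where \<pi>: "linear \<pi>" "\<And>z. \<pi> z \<in> Q" "\<And>z. z \<in> Q \<Longrightarrow> \<pi> z = z"
    using linear_projection_exists[OF Q(1)] by metis
  define I where "I = {l. \<exists>w\<in>V. w $ l \<noteq> 0}"
  have "\<exists>w\<in>V. w $ l = 1" if "l \<in> I" for l
  proof -
    obtain w where w: "w \<in> V" "w $ l \<noteq> 0" using \<open>l \<in> I\<close> by (auto simp: I_def)
    then show ?thesis
      by (intro bexI[of _ "inverse (w $ l) *\<^sub>R w"]) (auto simp: subspace_scale[OF V])
  qed
  then have "\<forall>l\<in>I. \<exists>w. w \<in> V \<and> w $ l = 1" by blast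
  \<comment> \<open>Writing a vector with l-th coordinate 1 as \<open>w l\<close> plus an element of
    \<open>Vs l\<close> turns an affine condition into a linear one, so the parameters range in a
    linear subspace.\<close>
  from bchoice[OF this] obtain w where w: "\<And>l. l \<in> I \<Longrightarrow> w l \<in> V" "\<And>l. l \<in> I \<Longrightarrow> w l $ l = 1"
    by blast
  \<comment> \<open>The basis expansion makes joint differentiability in \<open>x\<close> and
    \<open>u\<close> follow from that of \<open>x\<close> alone at each basis vector.\<close>
  define DD where "DD x u = (\<Sum>b\<in>Basis. (u \<bullet> b) *\<^sub>R D x b)" for x u
  have DD: "DD x u = D x u" if "x \<in> \<Omega>" for x u
    unfolding DD_def by (rule linear_euclidean_expansion[OF D(1)[OF that], symmetric])
  \<comment> \<open>The last parameter is a tuple whose l-th entry is 0; \<open>F l\<close> fills in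
    the only value of that entry for which the equation can hold. Bad tuples are thus values of some
    \<open>F l\<close>.\<close>
  define F :: "'m \<Rightarrow> (real^'m) \<times> (real^'m) \<times> (real^'m) \<times> (('r \<times> 'r)^'m) \<Rightarrow> ('r \<times> 'r)^'m" where
    "F l p = snd (snd (snd p)) - axis l (DD (fst p) (w l + fst (snd p)) + mult_i (DD (fst p) (fst (snd (snd p))))
      + (\<Sum>k\<in>UNIV. (w l + fst (snd p)) $ k *\<^sub>R snd (snd (snd p)) $ k
          + fst (snd (snd p)) $ k *\<^sub>R mult_i (snd (snd (snd p)) $ k)))" for l p
  define S where "S l = (V \<inter> \<Omega>) \<times> Vs l \<times> Vs l \<times> Qs l" for l
  have diff: "F l differentiable_on S l" for l
  proof -
    have "F l differentiable (at p within S l)" if "p \<in> S l" for p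
    proof -
      have x: "fst p \<in> \<Omega>" using that by (auto simp: S_def)
      have 1: "fst differentiable (at p within S l)"
        by (rule bounded_linear_imp_differentiable) (intro bounded_linear_intros)
      have 2: "(\<lambda>p. fst (snd p)) differentiable (at p within S l)"
        by (rule bounded_linear_imp_differentiable) (intro bounded_linear_intros)
      have 3: "(\<lambda>p. fst (snd (snd p))) differentiable (at p within S l)"
        by (rule bounded_linear_imp_differentiable) (intro bounded_linear_intros)
      have 4: "(\<lambda>p. snd (snd (snd p))) differentiable (at p within S l)"
        by (rule bounded_linear_imp_differentiable) (intro bounded_linear_intros)
      have bl: "(\<lambda>p. L (g p)) differentiable (at p within S l)"
        if "g differentiable (at p within S l)" "bounded_linear L"
        for L :: "'x::real_normed_vector \<Rightarrow> 'y::real_normed_vector" and g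
        by (rule differentiable_compose[OF bounded_linear_imp_differentiable[OF that(2)] that(1)])
      have ax: "bounded_linear (axis l :: ('r \<times> 'r) \<Rightarrow> ('r \<times> 'r)^'m)"
        by (rule linear_conv_bounded_linear[THEN iffD1]) (auto simp: linear_iff axis_def vec_eq_iff)
      have Dx: "(\<lambda>p. D (fst p) b) differentiable (at p within S l)" for b
        by (rule differentiable_compose[OF D(2)[OF x] 1])
      show ?thesis
        unfolding F_def DD_def
        by (intro differentiable_diff 4 bl[OF _ ax] differentiable_add differentiable_sum finite_Basis
            finite ballI differentiable_scaleR bl[OF _ bounded_linear_inner_left] differentiable_const 2
            bl[OF _ bounded_linear_mult_i] Dx bl[OF _ bounded_linear_vec_nth] 3)
    qed
    then show ?thesis by (auto simp: differentiable_on_def)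
  qed
  have neg: "negligible {z. \<pi> z \<in> F l ` S l}" if "l \<in> I" for l
  proof (rule negligible_vimage_lowdim_image[OF _ Q(1) _ _ diff \<pi>])
    obtain w' where w': "w' \<in> V" "w' $ l \<noteq> 0" using \<open>l \<in> I\<close> by (auto simp: I_def)
    note sl = dim_slice_less[OF V w', folded Vs_def]
    show "subspace (V \<times> Vs l \<times> Vs l \<times> Qs l)"
      by (intro subspace_Times V sl Q)
    show "S l \<subseteq> V \<times> Vs l \<times> Vs l \<times> Qs l" by (auto simp: S_def)
    have "dim (V \<times> Vs l \<times> Vs l \<times> Qs l) = dim V + (dim (Vs l) + (dim (Vs l) + dim (Qs l)))"
      by (simp add: dim_Times V sl Q subspace_Times)
    \<comment> \<open>With n = \<open>dim V\<close> the source has dimension at most n + 2(n - 1) +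
      \<open>dim Q\<close> - \<open>dim Y\<close>, and 3n \<le> \<open>dim Y\<close> + 1 makes this
      at most \<open>dim Q\<close> - 1.\<close>
    then show "dim (V \<times> Vs l \<times> Vs l \<times> Qs l) < dim Q"
      using sl(2) Q(3)[of l] dim by linarith
  qed
  define N where "N = (\<Union>l\<in>I. {z. \<pi> z \<in> F l ` S l})"
  have negN: "negligible N"
    unfolding N_def by (rule negligible_Union) (auto intro: neg)
  define U where "U = {z. norm (\<pi> z) < \<epsilon>}"
  have "open U"
    unfolding U_def
    by (intro open_Collect_less continuous_on_norm continuous_on_const linear_continuous_on
        linear_conv_bounded_linear[THEN iffD1, OF \<pi>(1)])
  moreover have "0 \<in> U" using \<epsilon> \<pi>(1) by (simp add: U_def linear_0)
  ultimately obtain z where z: "z \<in> U" "z \<notin> N"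
    using open_not_negligible negligible_subset[OF negN] by blast
  define a where "a = \<pi> z"
  show ?thesis
  proof
    show "norm a < \<epsilon>" using z by (simp add: a_def U_def)
    have aQ: "a \<in> Q" by (simp add: a_def \<pi>(2))
    then show aY: "a $ k \<in> Y" for k by (simp add: Q_def)
    fix x u v assume x: "x \<in> V \<inter> \<Omega>" and uv: "u \<in> V" "v \<in> V"
      and eq: "D x u + (\<Sum>k\<in>UNIV. u $ k *\<^sub>R a $ k) + mult_i (D x v + (\<Sum>k\<in>UNIV. v $ k *\<^sub>R a $ k)) = 0"
    define E where "E u = D x u + (\<Sum>k\<in>UNIV. u $ k *\<^sub>R a $ k)" for u
    have linE: "linear E"
      unfolding E_def using D(1) x
      by (auto simp: linear_iff scaleR_add_left sum.distrib scaleR_sum_right algebra_simps)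
    show "u = 0 \<and> v = 0"
    proof (rule ccontr)
      assume "\<not> (u = 0 \<and> v = 0)"
      then obtain l where l: "u $ l \<noteq> 0 \<or> v $ l \<noteq> 0" by (auto simp: vec_eq_iff)
      then have lI: "l \<in> I" using uv by (auto simp: I_def)
      define d where "d = (u $ l)\<^sup>2 + (v $ l)\<^sup>2"
      have d: "d > 0" using l by (auto simp: d_def sum_power2_gt_zero_iff)
      \<comment> \<open>s + i t is the complex inverse of u_l + i v_l. Multiplying u + i v by it
        gives u' + i v' with l-th coordinate 1, and stays in the kernel because that kernel is a
        complex subspace.\<close>
      define s t where "s = u $ l / d" and "t = - (v $ l) / d"
      define u' v' where "u' = s *\<^sub>R u - t *\<^sub>R v" and "v' = t *\<^sub>R u + s *\<^sub>R v"
      have u'l: "u' $ l = 1" and v'l: "v' $ l = 0"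
        using d by (auto simp: u'_def v'_def s_def t_def divide_simps d_def power2_eq_square)
      have u'V: "u' \<in> V" "v' \<in> V"
        using uv V by (auto simp: u'_def v'_def subspace_add subspace_diff subspace_scale)
      have "E u' + mult_i (E v') = s *\<^sub>R (E u + mult_i (E v)) + t *\<^sub>R mult_i (E u + mult_i (E v))"
        by (simp add: u'_def v'_def linear_add[OF linE] linear_diff[OF linE] linear_scale[OF linE]
            linear_add[OF linear_mult_i] linear_scale[OF linear_mult_i] algebra_simps)
      then have E0: "E u' + mult_i (E v') = 0"
        using eq by (simp add: E_def linear_0[OF linear_mult_i])
      define a' where "a' = a - axis l (a $ l)"
      have a'Q: "a' \<in> Qs l"
        using aY Y by (auto simp: a'_def Qs_def axis_def subspace_0)
      have "(\<Sum>k\<in>UNIV. u' $ k *\<^sub>R a $ k) = (\<Sum>k\<in>UNIV. u' $ k *\<^sub>R a' $ k + (if k = l then a $ l else 0))"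
        by (rule sum.cong) (auto simp: a'_def axis_def u'l)
      then have s1: "(\<Sum>k\<in>UNIV. u' $ k *\<^sub>R a $ k) = (\<Sum>k\<in>UNIV. u' $ k *\<^sub>R a' $ k) + a $ l"
        by (simp add: sum.distrib)
      have s2: "(\<Sum>k\<in>UNIV. v' $ k *\<^sub>R a $ k) = (\<Sum>k\<in>UNIV. v' $ k *\<^sub>R a' $ k)"
        by (rule sum.cong) (auto simp: a'_def axis_def v'l)
      have s3: "mult_i (\<Sum>k\<in>UNIV. v' $ k *\<^sub>R a' $ k) = (\<Sum>k\<in>UNIV. v' $ k *\<^sub>R mult_i (a' $ k))"
        by (simp add: linear_sum[OF linear_mult_i] linear_scale[OF linear_mult_i])
      have key: "D x u' + mult_i (D x v') + (\<Sum>k\<in>UNIV. u' $ k *\<^sub>R a' $ k + v' $ k *\<^sub>R mult_i (a' $ k)) = - (a $ l)"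
        using E0 unfolding E_def s1 s2 linear_add[OF linear_mult_i] s3
        by (simp add: sum.distrib eq_neg_iff_add_eq_0 algebra_simps)
      have "F l (x, u' - w l, v', a') = a' - axis l (- (a $ l))"
        using x by (simp add: F_def DD key)
      also have "\<dots> = a" by (auto simp: a'_def axis_def vec_eq_iff)
      finally have "a = F l (x, u' - w l, v', a')" ..
      moreover have "(x, u' - w l, v', a') \<in> S l"
        using x u'V w[OF lI] u'l v'l a'Q V by (auto simp: S_def Vs_def subspace_diff)
      ultimately have "a \<in> F l ` S l" by blast
      then show False using z(2) lI by (auto simp: N_def a_def)
    qed
  qed
qed

section \<open>Manifolds in coordinates\<close>

locale projected_manifold =
  fixes V :: "(real^'m) set" and X :: "'a topology"
    and A :: "('a set \<times> ('a \<Rightarrow> real^'m)) set" and \<pi> :: "real^'m \<Rightarrow> real^'m"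
  assumes subspace_V: "subspace V" and hausdorff: "Hausdorff_space X"
    and second_countable: "second_countable X" and atlas: "smooth_atlas V X A"
    and linear_\<pi>: "linear \<pi>" and \<pi>_in: "\<And>x. \<pi> x \<in> V" and \<pi>_id: "\<And>x. x \<in> V \<Longrightarrow> \<pi> x = x"
begin

abbreviation chart_inv :: "'a set \<times> ('a \<Rightarrow> real^'m) \<Rightarrow> real^'m \<Rightarrow> 'a" where
  "chart_inv c \<equiv> inv_into (fst c) (snd c)"

text \<open>Precomposing with the projection \<open>\<pi>\<close> onto \<open>V\<close> makes coordinate representations live on open
  subsets of \<open>real^'m\<close>, so that all derivatives can be taken at interior points.\<close>

definition chart_rep :: "'a set \<times> ('a \<Rightarrow> real^'m) \<Rightarrow> ('a \<Rightarrow> 'w) \<Rightarrow> real^'m \<Rightarrow> 'w" where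
  "chart_rep c F x = F (chart_inv c (\<pi> x))"

definition chart_dom :: "'a set \<times> ('a \<Rightarrow> real^'m) \<Rightarrow> 'a set \<Rightarrow> (real^'m) set" where
  "chart_dom c S = {x. \<pi> x \<in> snd c ` (fst c \<inter> S)}"

definition smooth_fun :: "('a \<Rightarrow> 'w::real_normed_vector) \<Rightarrow> bool" where
  "smooth_fun F \<longleftrightarrow> (\<forall>c\<in>A. \<forall>k. Ck_on k (chart_dom c UNIV) (chart_rep c F))"

definition chart_deriv ::
  "'a set \<times> ('a \<Rightarrow> real^'m) \<Rightarrow> ('a \<Rightarrow> 'w::real_normed_vector) \<Rightarrow> 'a \<Rightarrow> real^'m \<Rightarrow> 'w" where
  "chart_deriv c F q = frechet_derivative (chart_rep c F) (at (snd c q))"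

lemma bounded_linear_\<pi>: "bounded_linear \<pi>"
  using linear_\<pi> linear_conv_bounded_linear by blast

lemma chartD:
  assumes "c \<in> A"
  shows "openin X (fst c)" "openin (top_of_set V) (snd c ` fst c)"
    "homeomorphic_map (subtopology X (fst c)) (top_of_set (snd c ` fst c)) (snd c)"
    "inj_on (snd c) (fst c)" "fst c \<subseteq> topspace X"
proof -
  show 1: "openin X (fst c)" "openin (top_of_set V) (snd c ` fst c)"
    "homeomorphic_map (subtopology X (fst c)) (top_of_set (snd c ` fst c)) (snd c)"
    using atlas assms unfolding smooth_atlas_def by (auto simp: split_beta)
  show 2: "fst c \<subseteq> topspace X" using 1(1) by (rule openin_subset)
  then show "inj_on (snd c) (fst c)"
    using homeomorphic_imp_injective_map[OF 1(3)] by (simp add: Int_absorb1)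
qed

lemma chart_cover:
  assumes "q \<in> topspace X"
  obtains c where "c \<in> A" "q \<in> fst c"
proof -
  have "q \<in> (\<Union>(U, \<phi>)\<in>A. U)" using assms atlas unfolding smooth_atlas_def by blast
  then show ?thesis using that by auto
qed

lemma chart_in_V: "c \<in> A \<Longrightarrow> q \<in> fst c \<Longrightarrow> snd c q \<in> V"
  using chartD(2) openin_imp_subset by blast

lemma chart_inv_chart [simp]: "c \<in> A \<Longrightarrow> q \<in> fst c \<Longrightarrow> chart_inv c (snd c q) = q"
  using chartD(4) inv_into_f_f by metis

lemma open_vimage_\<pi>:
  assumes "openin (top_of_set V) S"
  shows "open {x. \<pi> x \<in> S}"
proof -
  obtain T where "open T" "S = V \<inter> T" using assms by (auto simp: openin_open)
  then have "{x. \<pi> x \<in> S} = \<pi> -` T" using \<pi>_in by auto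
  then show ?thesis
    using \<open>open T\<close> bounded_linear_\<pi> by (simp add: linear_continuous_at continuous_open_vimage)
qed

lemma openin_chart_image:
  assumes "c \<in> A" "openin X S"
  shows "openin (top_of_set V) (snd c ` (fst c \<inter> S))"
proof -
  have "openin (subtopology X (fst c)) (fst c \<inter> S)"
    using assms(2) by (rule openin_subtopology_Int2)
  then have "openin (top_of_set (snd c ` fst c)) (snd c ` (fst c \<inter> S))"
    using homeomorphic_imp_open_map[OF chartD(3)[OF assms(1)]] by (simp add: open_map_def)
  then show ?thesis using chartD(2)[OF assms(1)] openin_trans by blast
qed

lemma open_chart_dom: "c \<in> A \<Longrightarrow> openin X S \<Longrightarrow> open (chart_dom c S)"
  unfolding chart_dom_def by (intro open_vimage_\<pi> openin_chart_image)

lemma open_chart_dom_UNIV [intro]: "c \<in> A \<Longrightarrow> open (chart_dom c UNIV)"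
  unfolding chart_dom_def by (auto intro: open_vimage_\<pi> chartD)

lemma chart_dom_iff:
  "c \<in> A \<Longrightarrow> x \<in> chart_dom c S \<longleftrightarrow> (\<exists>q\<in>fst c \<inter> S. \<pi> x = snd c q \<and> chart_inv c (\<pi> x) = q)"
  unfolding chart_dom_def using chart_inv_chart by fastforce

lemma chart_mem_dom: "c \<in> A \<Longrightarrow> q \<in> fst c \<Longrightarrow> q \<in> S \<Longrightarrow> snd c q \<in> chart_dom c S"
  unfolding chart_dom_def using chart_in_V \<pi>_id by auto

lemma openin_chart_vimage:
  assumes "c \<in> A" "open B"
  shows "openin X {q \<in> fst c. snd c q \<in> B}"
proof -
  have "continuous_map (subtopology X (fst c)) (top_of_set (snd c ` fst c)) (snd c)"
    using homeomorphic_imp_continuous_map chartD(3)[OF assms(1)] by blast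
  then have "continuous_map (subtopology X (fst c)) euclidean (snd c)"
    by (simp add: continuous_map_in_subtopology)
  then have "openin (subtopology X (fst c)) {q \<in> topspace (subtopology X (fst c)). snd c q \<in> B}"
    using assms(2) by (intro openin_continuous_map_preimage) auto
  then have "openin (subtopology X (fst c)) {q \<in> fst c. snd c q \<in> B}"
    using chartD(5)[OF assms(1)] by (simp add: Int_absorb1)
  then show ?thesis using openin_trans_full chartD(1)[OF assms(1)] by blast
qed

lemma compactin_chart_vimage:
  assumes "c \<in> A" "compact C" "C \<subseteq> snd c ` fst c"
  shows "compactin X {q \<in> fst c. snd c q \<in> C}"
proof -
  let ?K = "{q \<in> fst c. snd c q \<in> C}"
  have "snd c ` ?K = C" using assms(3) by auto
  then have "compactin (top_of_set (snd c ` fst c)) (snd c ` ?K)"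
    using assms(2,3) by (simp only: compactin_subtopology compactin_euclidean_iff)
  moreover have "?K \<subseteq> topspace (subtopology X (fst c))"
    using chartD(5)[OF assms(1)] by auto
  ultimately have "compactin (subtopology X (fst c)) ?K"
    using homeomorphic_map_compactness[OF chartD(3)[OF assms(1)]] by blast
  then show ?thesis by (simp add: compactin_subtopology)
qed

text \<open>A local extension of \<open>h\<close> and \<open>h\<close> itself agree on
  \<open>S\<close>, and \<open>\<pi>\<close> maps into \<open>S\<close> on an open set; so after
  composition with \<open>\<pi>\<close> the choice of extension disappears.\<close>

lemma Ck_on_compose_\<pi>:
  fixes h :: "real^'m \<Rightarrow> 'w::real_normed_vector"
  assumes S: "openin (top_of_set V) S" and h: "smooth_on S h"
  shows "Ck_on k {x. \<pi> x \<in> S} (\<lambda>x. h (\<pi> x))"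
proof (rule Ck_on_local)
  fix x assume "x \<in> {x. \<pi> x \<in> S}"
  then have "\<pi> x \<in> S" by simp
  with h[unfolded smooth_on_def] have "\<exists>W g. open W \<and> \<pi> x \<in> W \<and> (\<forall>k. Ck_on k W g) \<and> (\<forall>y\<in>S \<inter> W. g y = h y)"
    by (rule bspec)
  then obtain W g where W: "open W" "\<pi> x \<in> W" "\<forall>k. Ck_on k W g" "\<forall>y\<in>S \<inter> W. g y = h y"
    by (elim exE conjE)
  let ?W = "{x. \<pi> x \<in> S} \<inter> \<pi> -` W"
  have op: "open ?W"
    using open_vimage_\<pi>[OF S] W(1) bounded_linear_\<pi>
    by (intro open_Int) (auto simp: linear_continuous_at continuous_open_vimage)
  have "Ck_on k ?W (\<lambda>x. g (\<pi> x))"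
    by (rule Ck_on_compose[OF op W(1) Ck_on_bounded_linear[OF bounded_linear_\<pi>] W(3)[rule_format]]) auto
  then have "Ck_on k ?W (\<lambda>x. h (\<pi> x))"
    by (rule Ck_on_cong[OF op, rotated]) (use W(4) in auto)
  then show "\<exists>W'. open W' \<and> x \<in> W' \<and> Ck_on k W' (\<lambda>x. h (\<pi> x))"
    using op W(2) \<open>x \<in> _\<close> by (intro exI[of _ ?W]) auto
qed

text \<open>The representation composed with \<open>\<pi>\<close> is itself a smooth extension to an
  open set, so one extension serves at all points.\<close>

lemma smooth_on_chart:
  assumes "smooth_fun F" "c \<in> A"
  shows "smooth_on (snd c ` fst c) (\<lambda>x. F (chart_inv c x))"
  unfolding smooth_on_def
proof
  fix x assume x: "x \<in> snd c ` fst c"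
  show "\<exists>W g. open W \<and> x \<in> W \<and> (\<forall>k. Ck_on k W g) \<and>
      (\<forall>y\<in>snd c ` fst c \<inter> W. g y = F (chart_inv c y))"
  proof (intro exI conjI)
    show "open (chart_dom c UNIV)" using assms(2) by blast
    show "x \<in> chart_dom c UNIV" using x chart_mem_dom[OF assms(2)] by blast
    show "\<forall>k. Ck_on k (chart_dom c UNIV) (chart_rep c F)"
      using assms by (simp add: smooth_fun_def)
    show "\<forall>y\<in>snd c ` fst c \<inter> chart_dom c UNIV. chart_rep c F y = F (chart_inv c y)"
      using chart_in_V[OF assms(2)] \<pi>_id by (auto simp: chart_rep_def)
  qed
qed

section \<open>Smooth functions on the manifold and their derivatives in charts\<close>

lemma chart_rep_cong:
  assumes "c \<in> A" "\<And>q. q \<in> S \<Longrightarrow> F q = G q" "x \<in> chart_dom c S"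
  shows "chart_rep c F x = chart_rep c G x"
  using assms by (auto simp: chart_rep_def chart_dom_iff)

lemma smooth_fun_local:
  assumes "\<And>q. q \<in> topspace X \<Longrightarrow>
    \<exists>S G. openin X S \<and> q \<in> S \<and> smooth_fun G \<and> (\<forall>p\<in>S. F p = G p)"
  shows "smooth_fun F"
  unfolding smooth_fun_def
proof (intro ballI allI)
  fix c k assume c: "c \<in> A"
  show "Ck_on k (chart_dom c UNIV) (chart_rep c F)"
  proof (rule Ck_on_local)
    fix x assume "x \<in> chart_dom c UNIV"
    then obtain q where q: "q \<in> fst c" "\<pi> x = snd c q" using c by (auto simp: chart_dom_iff)
    then obtain S G where S: "openin X S" "q \<in> S" "smooth_fun G" "\<And>p. p \<in> S \<Longrightarrow> F p = G p"
      using assms[of q] chartD(5)[OF c] by blast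
    have "Ck_on k (chart_dom c S) (chart_rep c G)"
      using S(3) c unfolding smooth_fun_def by (auto intro: Ck_on_mono simp: chart_dom_def)
    then have "Ck_on k (chart_dom c S) (chart_rep c F)"
      by (rule Ck_on_cong[OF open_chart_dom[OF c S(1)], rotated])
         (use chart_rep_cong[OF c, of S G F] S(4) in auto)
    moreover have "x \<in> chart_dom c S" using q S(2) by (auto simp: chart_dom_def)
    ultimately show "\<exists>W'. open W' \<and> x \<in> W' \<and> Ck_on k W' (chart_rep c F)"
      using open_chart_dom[OF c S(1)] by blast
  qed
qed

lemma smooth_fun_const: "smooth_fun (\<lambda>q. a)"
  by (simp add: smooth_fun_def chart_rep_def[abs_def])

lemma smooth_funI:
  "(\<And>c k. c \<in> A \<Longrightarrow> Ck_on k (chart_dom c UNIV) (\<lambda>x. F (chart_inv c (\<pi> x)))) \<Longrightarrow> smooth_fun F"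
  by (simp add: smooth_fun_def chart_rep_def[abs_def])

lemma smooth_funD:
  "smooth_fun F \<Longrightarrow> c \<in> A \<Longrightarrow> Ck_on k (chart_dom c UNIV) (\<lambda>x. F (chart_inv c (\<pi> x)))"
  by (simp add: smooth_fun_def chart_rep_def[abs_def])

lemma smooth_fun_bounded_linear:
  assumes "bounded_linear L" "smooth_fun F"
  shows "smooth_fun (\<lambda>q. L (F q))"
  by (intro smooth_funI Ck_on_linear_compose[OF assms(1)] smooth_funD[OF assms(2)] open_chart_dom_UNIV)

lemma smooth_fun_add_sum:
  assumes "smooth_fun F" "\<And>k. smooth_fun (G k)"
  shows "smooth_fun (\<lambda>q. F q + (\<Sum>k\<in>(UNIV::'k::finite set). G k q *\<^sub>R a $ k))"
  by (intro smooth_funI Ck_on_add Ck_on_sum Ck_on_scaleR finite Ck_on_const smooth_funD[OF assms(1)]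
      smooth_funD[OF assms(2)]      open_chart_dom_UNIV)

text \<open>The second claim, which takes two derivatives, is what lets the point of the manifold
  itself be a parameter in the null set argument.\<close>

lemma chart_rep_differentiable:
  assumes "smooth_fun F" "c \<in> A" "x \<in> chart_dom c UNIV"
  shows "chart_rep c F differentiable (at x)"
    "(\<lambda>x. frechet_derivative (chart_rep c F) (at x) b) differentiable (at x)"
proof -
  have "Ck_on (Suc (Suc 0)) (chart_dom c UNIV) (chart_rep c F)"
    using assms(1,2) by (simp only: smooth_fun_def)
  then show "chart_rep c F differentiable (at x)"
    "(\<lambda>x. frechet_derivative (chart_rep c F) (at x) b) differentiable (at x)"
    using assms(3) by simp_all
qed

lemma chart_deriv_works:
  assumes "smooth_fun F" "c \<in> A" "q \<in> fst c"
  shows "(chart_rep c F has_derivative chart_deriv c F q) (at (snd c q))"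
  unfolding chart_deriv_def
  by (intro has_frechet_derivative chart_rep_differentiable chart_mem_dom assms UNIV_I)

lemma linear_chart_deriv: "smooth_fun F \<Longrightarrow> c \<in> A \<Longrightarrow> q \<in> fst c \<Longrightarrow> linear (chart_deriv c F q)"
  by (rule has_derivative_linear[OF chart_deriv_works])

lemma chart_deriv_cong:
  assumes "c \<in> A" "q \<in> fst c" "openin X S" "q \<in> S" "\<And>p. p \<in> S \<Longrightarrow> F p = G p"
  shows "chart_deriv c F q = chart_deriv c G q"
  unfolding chart_deriv_def
  by (rule frechet_derivative_cong_open[OF open_chart_dom[OF assms(1,3)] chart_mem_dom[OF assms(1,2,4)]])
     (use chart_rep_cong[OF assms(1)] assms(5) in blast)

lemma chart_deriv_add_sum:
  assumes "smooth_fun F" "\<And>k. smooth_fun (G k)" "c \<in> A" "q \<in> fst c"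
  shows "chart_deriv c (\<lambda>q. F q + (\<Sum>k\<in>(UNIV::'k::finite set). G k q *\<^sub>R a $ k)) q u =
    chart_deriv c F q u + (\<Sum>k\<in>UNIV. chart_deriv c (G k) q u *\<^sub>R a $ k)"
proof -
  have "(chart_rep c (\<lambda>q. F q + (\<Sum>k\<in>UNIV. G k q *\<^sub>R a $ k)) has_derivative
     (\<lambda>u. chart_deriv c F q u + (\<Sum>k\<in>UNIV. chart_deriv c (G k) q u *\<^sub>R a $ k))) (at (snd c q))"
    unfolding chart_rep_def[abs_def]
    by (intro has_derivative_add has_derivative_sum has_derivative_scaleR_left)
       (use chart_deriv_works[unfolded chart_rep_def[abs_def]] assms in blast)+
  then show ?thesis unfolding chart_deriv_def by (simp add: frechet_derivative_eq)
qed

lemma smooth_transition: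
  assumes "c \<in> A" "d \<in> A"
  shows "Ck_on k (chart_dom d (fst c)) (\<lambda>x. snd c (chart_inv d (\<pi> x)))"
proof -
  have "smooth_on (snd d ` (fst d \<inter> fst c)) (\<lambda>x. snd c (chart_inv d x))"
    using atlas assms unfolding smooth_atlas_def by (auto simp: split_beta)
  then show ?thesis
    unfolding chart_dom_def
    by (intro Ck_on_compose_\<pi> openin_chart_image assms chartD)
qed

text \<open>\<open>T\<close> is the derivative of the transition map from \<open>d\<close> to \<open>c\<close>.\<close>

lemma chart_change:
  assumes c: "c \<in> A" "q \<in> fst c" and d: "d \<in> A" "q \<in> fst d"
  obtains T where "\<And>u. T u \<in> V" "\<And>u. u \<in> V \<Longrightarrow> T u = 0 \<Longrightarrow> u = 0"
    "\<And>F u. smooth_fun (F :: 'a \<Rightarrow> 'w::real_normed_vector) \<Longrightarrow> chart_deriv d F q u = chart_deriv c F q (T u)"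
proof -
  define \<tau> where "\<tau> c d x = snd c (chart_inv d (\<pi> x))" for c d :: "'a set \<times> ('a \<Rightarrow> real^'m)" and x
  have \<tau>_diff: "\<tau> c d differentiable (at (snd d q))" if "c \<in> A" "d \<in> A" "q \<in> fst c" "q \<in> fst d" for c d
    using smooth_transition[OF that(1,2), of 1] chart_mem_dom[OF that(2,4,3)]
    by (auto simp: \<tau>_def[abs_def])
  define T where "T = frechet_derivative (\<tau> c d) (at (snd d q))"
  define R where "R = frechet_derivative (\<tau> d c) (at (snd c q))"
  have T: "(\<tau> c d has_derivative T) (at (snd d q))"
    unfolding T_def by (intro has_frechet_derivative \<tau>_diff c d)
  have R: "(\<tau> d c has_derivative R) (at (snd c q))"
    unfolding R_def by (intro has_frechet_derivative \<tau>_diff c d)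
  have \<tau>q: "\<tau> c d (snd d q) = snd c q"
    using c d by (simp add: \<tau>_def chart_in_V \<pi>_id)
  let ?W = "chart_dom d (fst c)"
  have W: "open ?W" "snd d q \<in> ?W"
    using open_chart_dom chart_mem_dom chartD(1) c d by auto
  have in_W: "\<pi> x = snd d p \<Longrightarrow> p \<in> fst c \<inter> fst d \<Longrightarrow> \<tau> c d x = snd c p" for x p
    using d by (simp add: \<tau>_def)
  show ?thesis
  proof
    \<comment> \<open>Near the point the transition map takes values in \<open>V\<close>, so
      composing it with \<open>\<pi>\<close> changes nothing; differentiating gives
      \<open>T = \<pi> \<circ> T\<close>.\<close>
    have "((\<lambda>x. \<pi> (\<tau> c d x)) has_derivative (\<lambda>u. \<pi> (T u))) (at (snd d q))"
      by (rule bounded_linear.has_derivative[OF bounded_linear_\<pi> T])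
    moreover have "((\<lambda>x. \<pi> (\<tau> c d x)) has_derivative T) (at (snd d q))"
      by (rule has_derivative_transform_within_open[OF T W])
         (use d c in_W chart_in_V[OF c(1)] \<pi>_id in \<open>auto simp: chart_dom_iff\<close>)
    ultimately have "T = (\<lambda>u. \<pi> (T u))" using has_derivative_unique by metis
    then show "T u \<in> V" for u using \<pi>_in by metis
    \<comment> \<open>The two transitions compose to \<open>\<pi>\<close> rather than to the
      identity, which still makes \<open>R\<close> a left inverse of \<open>T\<close> on
      \<open>V\<close>.\<close>
    have "((\<lambda>x. \<tau> d c (\<tau> c d x)) has_derivative (\<lambda>u. R (T u))) (at (snd d q))"
      using has_derivative_compose[OF T, of "\<tau> d c" R] R \<tau>q by simp
    moreover have "((\<lambda>x. \<tau> d c (\<tau> c d x)) has_derivative \<pi>) (at (snd d q))"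
    proof (rule has_derivative_transform_within_open[OF _ W])
      show "(\<pi> has_derivative \<pi>) (at (snd d q))"
        by (rule bounded_linear_imp_has_derivative[OF bounded_linear_\<pi>])
      fix x assume "x \<in> ?W"
      then obtain p where p: "p \<in> fst d" "p \<in> fst c" "\<pi> x = snd d p" using d by (auto simp: chart_dom_iff)
      then have "\<tau> c d x = snd c p" using in_W by auto
      then show "\<pi> x = \<tau> d c (\<tau> c d x)"
        using p c by (simp add: \<tau>_def chart_in_V \<pi>_id)
    qed
    ultimately have "R (T u) = \<pi> u" for u using has_derivative_unique by metis
    moreover have "R 0 = 0" using has_derivative_linear[OF R] by (rule linear_0)
    ultimately show "u \<in> V \<Longrightarrow> T u = 0 \<Longrightarrow> u = 0" for u using \<pi>_id by metis
    fix F :: "'a \<Rightarrow> 'w" and u assume F: "smooth_fun F"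
    have "((\<lambda>x. chart_rep c F (\<tau> c d x)) has_derivative (\<lambda>u. chart_deriv c F q (T u))) (at (snd d q))"
      using has_derivative_compose[OF T, of "chart_rep c F"] chart_deriv_works[OF F c] \<tau>q by simp
    then have "(chart_rep d F has_derivative (\<lambda>u. chart_deriv c F q (T u))) (at (snd d q))"
    proof (rule has_derivative_transform_within_open[OF _ W])
      fix x assume "x \<in> ?W"
      then obtain p where p: "p \<in> fst d" "p \<in> fst c" "\<pi> x = snd d p" using d by (auto simp: chart_dom_iff)
      then have "\<tau> c d x = snd c p" using in_W by auto
      then show "chart_rep c F (\<tau> c d x) = chart_rep d F x"
        using p c d by (simp add: chart_rep_def chart_in_V \<pi>_id)
    qed
    then show "chart_deriv d F q u = chart_deriv c F q (T u)"
      unfolding chart_deriv_def[of d] by (simp add: frechet_derivative_eq)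
  qed
qed

end

section \<open>Totally real maps\<close>

lemma norm_mult_i [simp]: "norm (mult_i z) = norm z"
  by (simp add: mult_i_def norm_prod_def add.commute)

context projected_manifold
begin

definition zero_extension :: "'a set \<times> ('a \<Rightarrow> real^'m) \<Rightarrow> (real^'m \<Rightarrow> 'w::zero) \<Rightarrow> 'a \<Rightarrow> 'w" where
  "zero_extension c H q = (if q \<in> fst c then H (snd c q) else 0)"

text \<open>Inside the chart \<open>c\<close> this is a composition with a transition map. A point
  outside it has a neighbourhood on which the extension is zero, because the compact set carrying
  \<open>H\<close> is closed in the Hausdorff space \<open>X\<close>.\<close>

lemma smooth_fun_zero_extension:
  assumes c: "c \<in> A" and H: "\<And>k. Ck_on k UNIV H" and C: "compact C" "C \<subseteq> snd c ` fst c"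
    and zero: "\<And>x. x \<in> V - C \<Longrightarrow> H x = 0"
  shows "smooth_fun (zero_extension c H)"
proof (rule smooth_funI)
  fix d k assume d: "d \<in> A"
  let ?f = "\<lambda>x. zero_extension c H (chart_inv d (\<pi> x))"
  show "Ck_on k (chart_dom d UNIV) ?f"
  proof (rule Ck_on_local)
    fix x assume "x \<in> chart_dom d UNIV"
    then obtain q where q: "q \<in> fst d" "\<pi> x = snd d q" using d by (auto simp: chart_dom_iff)
    show "\<exists>W'. open W' \<and> x \<in> W' \<and> Ck_on k W' ?f"
    proof (cases "q \<in> fst c")
      case True
      let ?W = "chart_dom d (fst c)"
      have op: "open ?W" by (intro open_chart_dom d chartD c)
      have "Ck_on k ?W (\<lambda>x. H (snd c (chart_inv d (\<pi> x))))"
        by (rule Ck_on_compose[OF op open_UNIV smooth_transition[OF c d] H]) simp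
      then have "Ck_on k ?W ?f"
        by (rule Ck_on_cong[OF op, rotated]) (use d in \<open>auto simp: chart_dom_iff zero_extension_def\<close>)
      moreover have "x \<in> ?W" using q True by (auto simp: chart_dom_def)
      ultimately show ?thesis using op by blast
    next
      case False
      define S where "S = topspace X - {q \<in> fst c. snd c q \<in> C}"
      have S: "openin X S"
        unfolding S_def
        using compactin_imp_closedin[OF hausdorff compactin_chart_vimage[OF c C]]
        by (simp add: closedin_def)
      have op: "open (chart_dom d S)" by (rule open_chart_dom[OF d S])
      have "zero_extension c H p = 0" if "p \<in> S" for p
        using that zero[of "snd c p"] chart_in_V[OF c] by (auto simp: zero_extension_def S_def)
      then have "Ck_on k (chart_dom d S) ?f"
        by (intro Ck_on_cong[OF op _ Ck_on_const[of k _ 0]]) (use d in \<open>auto simp: chart_dom_iff\<close>)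
      moreover have "x \<in> chart_dom d S"
        using q False chartD(5)[OF d] by (auto simp: chart_dom_def S_def)
      ultimately show ?thesis using op by blast
    qed
  qed
qed

text \<open>The equation says that the complexified differential kills \<open>u + i v\<close>; excluding it expresses
  injectivity and the absence of complex lines at once.\<close>

definition totally_real_at :: "('a \<Rightarrow> 'r \<times> 'r::real_normed_vector) \<Rightarrow> 'a \<Rightarrow> bool" where
  "totally_real_at F q \<longleftrightarrow> (\<forall>c\<in>A. q \<in> fst c \<longrightarrow> (\<forall>u\<in>V. \<forall>v\<in>V.
     chart_deriv c F q u + mult_i (chart_deriv c F q v) = 0 \<longrightarrow> u = 0 \<and> v = 0))"

text \<open>Changing the chart replaces \<open>u\<close> and \<open>v\<close> by their images under
  a map that sends \<open>V\<close> into \<open>V\<close> and only 0 to 0, so one chart decides the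
  condition for all.\<close>

lemma totally_real_at_chartI:
  fixes F :: "'a \<Rightarrow> 'r::real_normed_vector \<times> 'r"
  assumes "smooth_fun F" "c \<in> A" "q \<in> fst c"
    and "\<And>u v. u \<in> V \<Longrightarrow> v \<in> V \<Longrightarrow>
      chart_deriv c F q u + mult_i (chart_deriv c F q v) = 0 \<Longrightarrow> u = 0 \<and> v = 0"
  shows "totally_real_at F q"
  unfolding totally_real_at_def
proof (intro ballI impI)
  fix d u v assume d: "d \<in> A" "q \<in> fst d" and uv: "u \<in> V" "v \<in> V"
    and eq: "chart_deriv d F q u + mult_i (chart_deriv d F q v) = 0"
  obtain T where T: "\<And>u. T u \<in> V" "\<And>u. u \<in> V \<Longrightarrow> T u = 0 \<Longrightarrow> u = 0"
    "\<And>F u. smooth_fun (F :: 'a \<Rightarrow> 'r \<times> 'r) \<Longrightarrow> chart_deriv d F q u = chart_deriv c F q (T u)"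
    by (rule chart_change[OF assms(2,3) d, where 'w = "'r \<times> 'r"]) (rule that)
  show "u = 0 \<and> v = 0"
    using assms(4)[OF T(1) T(1), of u v] eq T(2) uv unfolding T(3)[OF assms(1)] by blast
qed

lemma totally_real_at_cong:
  assumes "openin X S" "q \<in> S" "\<And>p. p \<in> S \<Longrightarrow> F p = G p"
  shows "totally_real_at F q \<longleftrightarrow> totally_real_at G q"
  using chart_deriv_cong[OF _ _ assms] unfolding totally_real_at_def by auto

text \<open>An injective linear map on the finite-dimensional space \<open>V \<times> V\<close>
  expands norms by at least some factor \<open>e > 0\<close>. Perturbations smaller than
  \<open>e\<close> keep it injective, and the derivative depends continuously on both the point and
  \<open>a\<close>.\<close>

lemma totally_real_at_stable_local:
  fixes F :: "'a \<Rightarrow> 'r::euclidean_space \<times> 'r" and G :: "'k::finite \<Rightarrow> 'a \<Rightarrow> real"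
  assumes F: "smooth_fun F" and G: "\<And>k. smooth_fun (G k)" and q: "q \<in> topspace X"
    and tr: "totally_real_at F q"
  shows "\<exists>S \<epsilon>. openin X S \<and> q \<in> S \<and> \<epsilon> > 0 \<and>
    (\<forall>a. norm a < \<epsilon> \<longrightarrow> (\<forall>p\<in>S. totally_real_at (\<lambda>q. F q + (\<Sum>k\<in>UNIV. G k q *\<^sub>R a $ k)) p))"
proof -
  obtain c where c: "c \<in> A" "q \<in> fst c" using chart_cover[OF q] .
  define x0 where "x0 = snd c q"
  have x0: "x0 \<in> chart_dom c UNIV" unfolding x0_def using c by (rule chart_mem_dom) simp
  define D where "D x = frechet_derivative (chart_rep c F) (at x)" for x
  define DG where "DG k x = frechet_derivative (chart_rep c (G k)) (at x)" for k x
  have cD: "isCont (\<lambda>x. D x b) x0" and cDG: "isCont (\<lambda>x. DG k x b) x0" for k b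
    unfolding D_def DG_def
    by (intro differentiable_imp_continuous_within chart_rep_differentiable F G c x0)+
  have lD0: "linear (D x0)"
    unfolding D_def x0_def using linear_chart_deriv[OF F c] by (simp add: chart_deriv_def)
  define T where "T w = D x0 (fst w) + mult_i (D x0 (snd w))" for w
  have bD: "bounded_linear (D x0)"
    using lD0 linear_conv_bounded_linear by blast
  have "bounded_linear (\<lambda>w. D x0 (fst w) + mult_i (D x0 (snd w)))"
    by (rule bounded_linear_add[OF bounded_linear_compose[OF bD bounded_linear_fst]
        bounded_linear_compose[OF bounded_linear_mult_i bounded_linear_compose[OF bD bounded_linear_snd]]])
  then have "bounded_linear T" by (simp only: T_def[abs_def])
  moreover have "\<forall>w\<in>V \<times> V. T w = 0 \<longrightarrow> w = 0"
    using tr c unfolding totally_real_at_def T_def D_def x0_def chart_deriv_def by (auto simp: prod_eq_iff)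
  moreover have VV: "subspace (V \<times> V)" by (intro subspace_Times subspace_V)
  ultimately obtain e where e: "e > 0" "\<And>w. w \<in> V \<times> V \<Longrightarrow> e * norm w \<le> norm (T w)"
    using injective_imp_isometric[of "V \<times> V" T] closed_subspace[OF VV] by blast
  define E where "E a x b = D x b + (\<Sum>k\<in>UNIV. DG k x b *\<^sub>R a $ k) - D x0 b" for a :: "('r \<times> 'r)^'k" and x b
  \<comment> \<open>The sum over the basis bounds the operator norm of the change in the derivative.
    \<open>u\<close> and \<open>v\<close> each contribute once, which is why the threshold below is
    \<open>e / 2\<close>.\<close>
  define \<delta> where "\<delta> a x = (\<Sum>b\<in>Basis. norm (E a x b))" for a x
  have "((\<lambda>z. \<Sum>b\<in>Basis. norm (D (snd z) b + (\<Sum>k\<in>UNIV. DG k (snd z) b *\<^sub>R fst z $ k) - D x0 b))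
     \<longlongrightarrow> (\<Sum>b\<in>Basis. norm (D x0 b + (\<Sum>k\<in>UNIV. DG k x0 b *\<^sub>R (0::('r \<times> 'r)^'k) $ k) - D x0 b)))
     (nhds (0, x0))"
  proof -
    have s: "(snd \<longlongrightarrow> x0) (nhds (0::('r \<times> 'r)^'k, x0))" and f: "(fst \<longlongrightarrow> (0::('r \<times> 'r)^'k)) (nhds (0, x0))"
      using tendsto_snd[OF filterlim_ident[of "nhds (0, x0)"]]
        tendsto_fst[OF filterlim_ident[of "nhds (0, x0)"]] by simp_all
    show ?thesis
      by (intro tendsto_intros isCont_tendsto_compose[OF cD s] isCont_tendsto_compose[OF cDG s] f)
  qed
  then have "((\<lambda>z. \<delta> (fst z) (snd z)) \<longlongrightarrow> 0) (nhds (0, x0))"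
    unfolding \<delta>_def E_def by simp
  then have "eventually (\<lambda>z. \<delta> (fst z) (snd z) < e / 2) (nhds (0, x0))"
    using e(1) by (intro order_tendstoD) auto
  then obtain P Q where PQ: "eventually P (nhds 0)" "eventually Q (nhds x0)"
    "\<And>a x. P a \<Longrightarrow> Q x \<Longrightarrow> \<delta> a x < e / 2"
    unfolding nhds_prod eventually_prod_filter by auto
  obtain \<epsilon> where \<epsilon>: "\<epsilon> > 0" "\<And>a. norm a < \<epsilon> \<Longrightarrow> P a"
    using PQ(1) by (auto simp: eventually_nhds_metric dist_norm)
  obtain B where B: "open B" "x0 \<in> B" "\<And>x. x \<in> B \<Longrightarrow> Q x"
    using PQ(2) by (auto simp: eventually_nhds)
  define S where "S = {p \<in> fst c. snd c p \<in> B}"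
  have "totally_real_at (\<lambda>q. F q + (\<Sum>k\<in>UNIV. G k q *\<^sub>R a $ k)) p" if a: "norm a < \<epsilon>" and p: "p \<in> S" for a p
  proof (rule totally_real_at_chartI[OF smooth_fun_add_sum c(1)])
    let ?Fa = "\<lambda>q. F q + (\<Sum>k\<in>UNIV. G k q *\<^sub>R a $ k)"
    show pc: "p \<in> fst c" using p by (simp add: S_def)
    fix u v assume uv: "u \<in> V" "v \<in> V" and eq: "chart_deriv c ?Fa p u + mult_i (chart_deriv c ?Fa p v) = 0"
    define x where "x = snd c p"
    have \<delta>: "\<delta> a x < e / 2" using PQ(3) \<epsilon>(2)[OF a] B(3) p by (auto simp: S_def x_def)
    have lin: "linear (chart_deriv c ?Fa p)"
      by (rule linear_chart_deriv[OF smooth_fun_add_sum[OF F G] c(1) pc])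
    have Ea: "chart_deriv c ?Fa p b - D x0 b = E a x b" for b
      unfolding chart_deriv_add_sum[OF F G c(1) pc] E_def D_def DG_def x_def by (simp add: chart_deriv_def)
    have bound: "norm (chart_deriv c ?Fa p u - D x0 u) \<le> norm u * \<delta> a x" for u
    proof -
      have "linear (\<lambda>u. chart_deriv c ?Fa p u - D x0 u)"
        using lin lD0 by (rule linear_compose_sub)
      then have "chart_deriv c ?Fa p u - D x0 u = (\<Sum>b\<in>Basis. (u \<bullet> b) *\<^sub>R E a x b)"
        using linear_euclidean_expansion[of "\<lambda>u. chart_deriv c ?Fa p u - D x0 u" u] unfolding Ea by blast
      also have "norm \<dots> \<le> (\<Sum>b\<in>Basis. norm u * norm (E a x b))"
        by (rule sum_norm_le) (simp add: Basis_le_norm mult_right_mono)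
      finally show ?thesis by (simp add: \<delta>_def sum_distrib_left)
    qed
    have "norm u \<le> norm (u, v)" "norm v \<le> norm (u, v)"
      by (auto simp: norm_Pair)
    have \<delta>0: "\<delta> a x \<ge> 0" by (simp add: \<delta>_def sum_nonneg)
    have "T (u, v) = - ((chart_deriv c ?Fa p u - D x0 u) + mult_i (chart_deriv c ?Fa p v - D x0 v))"
      using eq by (simp add: T_def linear_diff[OF linear_mult_i] algebra_simps eq_neg_iff_add_eq_0)
    then have "norm (T (u, v)) = norm ((chart_deriv c ?Fa p u - D x0 u) + mult_i (chart_deriv c ?Fa p v - D x0 v))"
      by (simp only: norm_minus_cancel)
    also have "\<dots> \<le> norm (chart_deriv c ?Fa p u - D x0 u) + norm (chart_deriv c ?Fa p v - D x0 v)"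
      by (rule order_trans[OF norm_triangle_ineq]) (simp only: norm_mult_i order_refl)
    also have "\<dots> \<le> norm (u, v) * \<delta> a x + norm (u, v) * \<delta> a x"
      by (intro add_mono order_trans[OF bound] mult_right_mono \<delta>0) fact+
    finally have "e * norm (u, v) \<le> 2 * \<delta> a x * norm (u, v)"
      using e(2)[of "(u, v)"] uv by (simp add: algebra_simps)
    then have "norm (u, v) \<le> 0"
      using \<delta> mult_less_cancel_right[of "2 * \<delta> a x" "norm (u, v)" e] by linarith
    then show "u = 0 \<and> v = 0" by (simp add: prod_eq_iff)
  qed (rule F G)+
  moreover have "openin X S" "q \<in> S"
    using openin_chart_vimage[OF c(1) B(1)] B(2) c(2) by (auto simp: S_def x0_def)
  ultimately show ?thesis using \<epsilon>(1) by blast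
qed

lemma totally_real_stable:
  fixes F :: "'a \<Rightarrow> 'r::euclidean_space \<times> 'r" and G :: "'k::finite \<Rightarrow> 'a \<Rightarrow> real"
  assumes F: "smooth_fun F" and G: "\<And>k. smooth_fun (G k)" and K: "compactin X K"
    and tr: "\<And>q. q \<in> K \<Longrightarrow> totally_real_at F q"
  shows "\<exists>\<epsilon>>0. \<forall>a. norm a < \<epsilon> \<longrightarrow>
    (\<forall>p\<in>K. totally_real_at (\<lambda>q. F q + (\<Sum>k\<in>UNIV. G k q *\<^sub>R a $ k)) p)"
proof -
  define ok where "ok S \<epsilon> \<longleftrightarrow> \<epsilon> > 0 \<and> (\<forall>a. norm a < \<epsilon> \<longrightarrow>
    (\<forall>p\<in>S. totally_real_at (\<lambda>q. F q + (\<Sum>k\<in>UNIV. G k q *\<^sub>R a $ k)) p))" for S \<epsilon>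
  define \<U> where "\<U> = {S. openin X S \<and> (\<exists>\<epsilon>. ok S \<epsilon>)}"
  have "K \<subseteq> \<Union>\<U>"
  proof
    fix q assume "q \<in> K"
    then have "q \<in> topspace X" using compactin_subset_topspace[OF K] by blast
    have "\<exists>S \<epsilon>. openin X S \<and> q \<in> S \<and> ok S \<epsilon>"
      unfolding ok_def by (rule totally_real_at_stable_local[OF F G \<open>q \<in> topspace X\<close> tr[OF \<open>q \<in> K\<close>]])
    then show "q \<in> \<Union>\<U>" unfolding \<U>_def by blast
  qed
  then obtain \<F> where \<F>: "finite \<F>" "\<F> \<subseteq> \<U>" "K \<subseteq> \<Union>\<F>"
    using compactinD[OF K, of \<U>] unfolding \<U>_def by blast
  then have "\<forall>S\<in>\<F>. \<exists>\<epsilon>. ok S \<epsilon>" by (auto simp: \<U>_def)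
  from bchoice[OF this] obtain \<epsilon> where \<epsilon>: "\<forall>S\<in>\<F>. ok S (\<epsilon> S)" ..
  \<comment> \<open>The inserted 1 keeps the minimum meaningful when the finite cover is
    empty.\<close>
  define \<epsilon>0 where "\<epsilon>0 = Min (insert 1 (\<epsilon> ` \<F>))"
  have "\<epsilon>0 > 0" unfolding \<epsilon>0_def using \<F>(1) \<epsilon> by (auto simp: ok_def)
  moreover have "totally_real_at (\<lambda>q. F q + (\<Sum>k\<in>UNIV. G k q *\<^sub>R a $ k)) p"
    if a: "norm a < \<epsilon>0" and p: "p \<in> K" for a p
  proof -
    obtain S where S: "S \<in> \<F>" "p \<in> S" using p \<F>(3) by blast
    have "\<epsilon>0 \<le> \<epsilon> S" unfolding \<epsilon>0_def using \<F>(1) S(1) by (intro Min_le) auto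
    then show ?thesis using \<epsilon> S a unfolding ok_def by fastforce
  qed
  ultimately show ?thesis by blast
qed

section \<open>Globalisation\<close>

definition totally_real_on :: "('r \<times> 'r) set \<Rightarrow> ('a \<Rightarrow> 'r \<times> 'r::real_normed_vector) \<Rightarrow> 'a set \<Rightarrow> bool" where
  "totally_real_on Y F K \<longleftrightarrow> smooth_fun F \<and> range F \<subseteq> Y \<and> (\<forall>q\<in>K. totally_real_at F q)"

text \<open>The quantification over all \<open>F\<close> and all compact \<open>K\<close> allows
  corrections to be chained: what one of them achieves becomes part of the \<open>K\<close>
  protected by the next. \<open>S\<close> confines the change.\<close>

definition correctable :: "('r \<times> 'r::real_normed_vector) set \<Rightarrow> 'a set \<Rightarrow> 'a set \<Rightarrow> bool" where
  "correctable Y C S \<longleftrightarrow> (\<forall>F K. compactin X K \<longrightarrow> totally_real_on Y F K \<longrightarrow>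
     (\<exists>F'. totally_real_on Y F' (K \<union> C) \<and> (\<forall>q. q \<notin> S \<longrightarrow> F' q = F q)))"

lemma correctable_empty: "correctable Y {} S"
  unfolding correctable_def by auto

lemma totally_real_on_mono: "totally_real_on Y F K \<Longrightarrow> K' \<subseteq> K \<Longrightarrow> totally_real_on Y F K'"
  unfolding totally_real_on_def by blast

lemma correctable_mono:
  assumes "correctable Y C S" "C' \<subseteq> C"
  shows "correctable Y C' S"
  unfolding correctable_def
proof (intro allI impI)
  fix F K assume "compactin X K" "totally_real_on Y F K"
  then obtain F' where "totally_real_on Y F' (K \<union> C)" "\<forall>q. q \<notin> S \<longrightarrow> F' q = F q"
    using assms(1) unfolding correctable_def by blast
  then show "\<exists>F'. totally_real_on Y F' (K \<union> C') \<and> (\<forall>q. q \<notin> S \<longrightarrow> F' q = F q)"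
    using totally_real_on_mono[of Y F' "K \<union> C" "K \<union> C'"] assms(2) by blast
qed

text \<open>Compactness of \<open>C\<close> allows it to join the protected set before
  \<open>C'\<close> is treated.\<close>

lemma correctable_Un:
  assumes "correctable Y C S" "compactin X C" "correctable Y C' S"
  shows "correctable Y (C \<union> C') S"
  unfolding correctable_def
proof (intro allI impI)
  fix F K assume K: "compactin X K" "totally_real_on Y F K"
  then obtain F' where F': "totally_real_on Y F' (K \<union> C)" "\<forall>q. q \<notin> S \<longrightarrow> F' q = F q"
    using assms(1) unfolding correctable_def by blast
  have "compactin X (K \<union> C)" using K(1) assms(2) by (rule compactin_Un)
  then obtain F'' where "totally_real_on Y F'' ((K \<union> C) \<union> C')" "\<forall>q. q \<notin> S \<longrightarrow> F'' q = F' q"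
    using assms(3) F'(1) unfolding correctable_def by blast
  then show "\<exists>F'. totally_real_on Y F' (K \<union> (C \<union> C')) \<and> (\<forall>q. q \<notin> S \<longrightarrow> F' q = F q)"
    using F'(2) by (intro exI[of _ F'']) (simp add: Un_assoc)
qed

text \<open>A single correction in one chart: stability on \<open>K\<close> fixes how small
  \<open>a\<close> must be, and general position then supplies a suitable \<open>a\<close> below
  that bound.\<close>

lemma correctable_nbhd:
  fixes Y :: "('r::euclidean_space \<times> 'r) set"
  assumes Y: "subspace Y" "3 * dim V \<le> dim Y + 1"
    and S: "openin X S" "p \<in> S"
  obtains P C where "openin X P" "compactin X C" "p \<in> P" "P \<subseteq> C" "C \<subseteq> S" "correctable Y C S"
proof -
  have "p \<in> topspace X" using S openin_subset by blast
  then obtain c where c: "c \<in> A" "p \<in> fst c" by (rule chart_cover)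
  define z where "z = snd c p"
  have "open (chart_dom c S)" "z \<in> chart_dom c S"
    unfolding z_def using open_chart_dom chart_mem_dom c S by auto
  then obtain e where e: "e > 0" "cball z e \<subseteq> chart_dom c S"
    using open_contains_cball by blast
  define r where "r = e / 2"
  have r: "r > 0" "cball z (2 * r) \<subseteq> chart_dom c S" using e by (auto simp: r_def)
  have in_image: "x \<in> snd c ` (fst c \<inter> S)" if "x \<in> cball z (2 * r)" "x \<in> V" for x
    using that r(2) \<pi>_id by (force simp: chart_dom_def)
  obtain b :: "real^'m \<Rightarrow> real" where b: "\<And>k. Ck_on k UNIV b" "\<And>x. x \<in> ball z r \<Longrightarrow> b x = 1"
    "\<And>x. x \<notin> cball z (2 * r) \<Longrightarrow> b x = 0"
    using smooth_cutoff_exists[OF r(1), of z] by metis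
  \<comment> \<open>Weighting \<open>H k\<close> by \<open>a $ k\<close> and summing gives the
    linear map with columns \<open>a $ k\<close>, multiplied by the cutoff.\<close>
  define H where "H k x = b x *\<^sub>R (x $ k)" for k and x :: "real^'m"
  define G where "G k = zero_extension c (H k)" for k
  have closedV: "closed V" using subspace_V by (rule closed_subspace)
  have smG: "smooth_fun (G k)" for k
    unfolding G_def
  proof (rule smooth_fun_zero_extension[OF c(1)])
    show "Ck_on l UNIV (H k)" for l
      unfolding H_def by (intro Ck_on_scaleR b Ck_on_bounded_linear bounded_linear_vec_nth open_UNIV)
    \<comment> \<open>The chart image is open only relative to \<open>V\<close>, so the ball has to
      be cut with \<open>V\<close> before it can lie in that image.\<close>
    show "compact (cball z (2 * r) \<inter> V)" using closedV by (intro compact_Int_closed) auto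
    show "cball z (2 * r) \<inter> V \<subseteq> snd c ` fst c" using in_image by blast
    show "H k x = 0" if "x \<in> V - cball z (2 * r) \<inter> V" for x
      using that b(3)[of x] by (auto simp: H_def)
  qed
  have in_S: "q \<in> S" if q: "q \<in> fst c" "snd c q \<in> cball z (2 * r)" for q
    using in_image[OF q(2) chart_in_V[OF c(1) q(1)]] q(1) inj_onD[OF chartD(4)[OF c(1)]] by blast
  have G_off: "G k q = 0" if "q \<notin> S" for k q
    using in_S that b(3) unfolding G_def zero_extension_def H_def by (cases "snd c q \<in> cball z (2 * r)") auto
  \<comment> \<open>Where the cutoff is 1, \<open>G k\<close> is the k-th coordinate function, so
    the perturbed derivative has exactly the form treated by general position.\<close>
  have dG: "chart_deriv c (G k) q u = u $ k" if q: "q \<in> fst c" "snd c q \<in> ball z r" and u: "u \<in> V" for k q u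
  proof -
    let ?W = "chart_dom c UNIV \<inter> \<pi> -` ball z r"
    have W: "open ?W" "snd c q \<in> ?W"
      using c(1) q chart_mem_dom[OF c(1) q(1)] chart_in_V[OF c(1) q(1)] \<pi>_id bounded_linear_\<pi>
      by (auto intro!: open_Int simp: linear_continuous_at continuous_open_vimage)
    have "((\<lambda>x. \<pi> x $ k) has_derivative (\<lambda>u. \<pi> u $ k)) (at (snd c q))"
      by (intro bounded_linear_imp_has_derivative bounded_linear_compose[OF bounded_linear_vec_nth bounded_linear_\<pi>])
    then have "(chart_rep c (G k) has_derivative (\<lambda>u. \<pi> u $ k)) (at (snd c q))"
    proof (rule has_derivative_transform_within_open[OF _ W])
      fix x assume x: "x \<in> ?W"
      then obtain p' where "p' \<in> fst c" "\<pi> x = snd c p'" "chart_inv c (\<pi> x) = p'"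
        using c(1) by (auto simp: chart_dom_iff)
      then show "\<pi> x $ k = chart_rep c (G k) x"
        using x b(2)[of "\<pi> x"] by (simp add: chart_rep_def G_def zero_extension_def H_def)
    qed
    then show ?thesis using u by (simp add: chart_deriv_def frechet_derivative_eq \<pi>_id)
  qed
  \<comment> \<open>Radius \<open>r / 2\<close> puts the compact set \<open>C\<close> strictly
    inside the ball of radius \<open>r\<close> where the cutoff is 1, and leaves an open
    \<open>P\<close> inside \<open>C\<close> for covering arguments.\<close>
  define C where "C = {q \<in> fst c. snd c q \<in> cball z (r / 2) \<inter> V}"
  define P where "P = {q \<in> fst c. snd c q \<in> ball z (r / 2)}"
  show ?thesis
  proof
    show "openin X P" unfolding P_def by (rule openin_chart_vimage[OF c(1) open_ball])
    have "cball z (r / 2) \<inter> V \<subseteq> snd c ` fst c"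
      using in_image r(1) by (force simp: mem_cball)
    then show "compactin X C"
      unfolding C_def by (intro compactin_chart_vimage[OF c(1)] compact_Int_closed closedV compact_cball)
    show "p \<in> P" using c r(1) by (simp add: P_def z_def)
    show "P \<subseteq> C" using chart_in_V[OF c(1)] by (auto simp: P_def C_def)
    show "C \<subseteq> S" using in_S r(1) by (force simp: C_def)
    show "correctable Y C S"
      unfolding correctable_def
    proof (intro allI impI)
      fix F K assume K: "compactin X K" and "totally_real_on Y F K"
      then have F: "smooth_fun F" "\<And>q. F q \<in> Y" "\<And>q. q \<in> K \<Longrightarrow> totally_real_at F q"
        by (auto simp: totally_real_on_def)
      have "\<exists>\<epsilon>>0. \<forall>a. norm a < \<epsilon> \<longrightarrow>
          (\<forall>p\<in>K. totally_real_at (\<lambda>q. F q + (\<Sum>k\<in>UNIV. G k q *\<^sub>R a $ k)) p)"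
        by (rule totally_real_stable[OF F(1) smG K F(3)])
      then obtain \<epsilon> where \<epsilon>: "\<epsilon> > 0"
        "\<And>a p. norm a < \<epsilon> \<Longrightarrow> p \<in> K \<Longrightarrow> totally_real_at (\<lambda>q. F q + (\<Sum>k\<in>UNIV. G k q *\<^sub>R a $ k)) p"
        by blast
      define D where "D x = frechet_derivative (chart_rep c F) (at x)" for x
      have linD: "linear (D x)" if "x \<in> chart_dom c UNIV" for x
        unfolding D_def using chart_rep_differentiable(1)[OF F(1) c(1) that] by (rule linear_frechet_derivative)
      have diffD: "(\<lambda>x. D x b) differentiable (at x)" if "x \<in> chart_dom c UNIV" for x b
        unfolding D_def by (rule chart_rep_differentiable(2)[OF F(1) c(1) that])
      obtain a :: "('r \<times> 'r)^'m" where a: "norm a < \<epsilon>" "\<And>k. a $ k \<in> Y"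
        "\<And>x u v. x \<in> V \<inter> chart_dom c UNIV \<Longrightarrow> u \<in> V \<Longrightarrow> v \<in> V \<Longrightarrow>
          D x u + (\<Sum>k\<in>UNIV. u $ k *\<^sub>R a $ k) + mult_i (D x v + (\<Sum>k\<in>UNIV. v $ k *\<^sub>R a $ k)) = 0 \<Longrightarrow>
          u = 0 \<and> v = 0"
        by (rule generic_perturbation_exists[OF subspace_V Y linD diffD \<epsilon>(1)]) blast+
      let ?F = "\<lambda>q. F q + (\<Sum>k\<in>UNIV. G k q *\<^sub>R a $ k)"
      have smF: "smooth_fun ?F" by (rule smooth_fun_add_sum[OF F(1) smG])
      have "range ?F \<subseteq> Y"
        using F(2) a(2) Y(1) by (auto intro!: subspace_add subspace_sum subspace_scale)
      moreover have "totally_real_at ?F q" if "q \<in> C" for q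
      proof (rule totally_real_at_chartI[OF smF c(1)])
        show q: "q \<in> fst c" using that by (simp add: C_def)
        have qb: "snd c q \<in> ball z r" using that r(1) by (auto simp: C_def)
        have eq: "chart_deriv c ?F q u = D (snd c q) u + (\<Sum>k\<in>UNIV. u $ k *\<^sub>R a $ k)" if "u \<in> V" for u
          using dG[OF q qb that] chart_deriv_add_sum[OF F(1) smG c(1) q, where a = a and u = u]
          by (simp add: D_def chart_deriv_def)
        fix u v assume uv: "u \<in> V" "v \<in> V" and "chart_deriv c ?F q u + mult_i (chart_deriv c ?F q v) = 0"
        then show "u = 0 \<and> v = 0"
          using a(3)[of "snd c q" u v] chart_in_V[OF c(1) q] chart_mem_dom[OF c(1) q UNIV_I]
          unfolding eq[OF uv(1)] eq[OF uv(2)] by blast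
      qed
      ultimately have "totally_real_on Y ?F (K \<union> C)"
        using smF \<epsilon>(2)[OF a(1)] by (auto simp: totally_real_on_def)
      then show "\<exists>F'. totally_real_on Y F' (K \<union> C) \<and> (\<forall>q. q \<notin> S \<longrightarrow> F' q = F q)"
        by (intro exI[of _ ?F]) (simp add: G_off)
    qed
  qed
qed

text \<open>Finitely many of the small neighbourhoods cover \<open>L\<close>. Their compact hulls
  are corrected one after another, and the result is then restricted to \<open>L\<close>.\<close>

lemma correctable_compact:
  fixes Y :: "('r::euclidean_space \<times> 'r) set"
  assumes Y: "subspace Y" "3 * dim V \<le> dim Y + 1"
    and L: "compactin X L" "L \<subseteq> S" "openin X S"
  shows "correctable Y L S"
proof -
  define \<U> where "\<U> = {P. openin X P \<and> (\<exists>C. P \<subseteq> C \<and> compactin X C \<and> correctable Y C S)}"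
  have "L \<subseteq> \<Union>\<U>"
  proof
    fix p assume "p \<in> L"
    then have "p \<in> S" using L by blast
    obtain P C where "openin X P" "compactin X C" "p \<in> P" "P \<subseteq> C" "C \<subseteq> S" "correctable Y C S"
      by (rule correctable_nbhd[OF Y L(3) \<open>p \<in> S\<close>])
    then show "p \<in> \<Union>\<U>" unfolding \<U>_def by blast
  qed
  then obtain \<F> where \<F>: "finite \<F>" "\<F> \<subseteq> \<U>" "L \<subseteq> \<Union>\<F>"
    using compactinD[OF L(1), of \<U>] unfolding \<U>_def by blast
  have "\<exists>C. \<Union>\<F> \<subseteq> C \<and> compactin X C \<and> correctable Y C S"
    using \<F>(1,2)
  proof (induction \<F>)
    case empty
    show ?case using correctable_empty by auto
  next
    case (insert P \<F>)
    then have "\<exists>C. \<Union>\<F> \<subseteq> C \<and> compactin X C \<and> correctable Y C S" by simp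
    then obtain C where C: "\<Union>\<F> \<subseteq> C" "compactin X C" "correctable Y C S" by (elim exE conjE)
    obtain C' where C': "P \<subseteq> C'" "compactin X C'" "correctable Y C' S"
      using insert.prems by (auto simp: \<U>_def)
    have "\<Union>(insert P \<F>) \<subseteq> C \<union> C'" using C(1) C'(1) by blast
    then show ?case
      by (intro exI[of _ "C \<union> C'"] conjI compactin_Un[OF C(2) C'(2)] correctable_Un[OF C(3,2) C'(3)])
  qed
  then obtain C where C: "\<Union>\<F> \<subseteq> C" "compactin X C" "correctable Y C S" by (elim exE conjE)
  show ?thesis by (rule correctable_mono[OF C(3) order_trans[OF \<F>(3) C(1)]])
qed

end

text \<open>The Lindelof property leaves countably many open sets \<open>P j\<close> with compact
  hulls \<open>C j\<close>. Both sequences of sets are finite unions of these, and compactness makes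
  each union of hulls fit into a longer union of the \<open>P j\<close>.\<close>

lemma compact_exhaustion:
  assumes lind: "Lindelof_space X"
    and nbhd: "\<And>p. p \<in> topspace X \<Longrightarrow> \<exists>P C. openin X P \<and> compactin X C \<and> p \<in> P \<and> P \<subseteq> C"
  obtains K S :: "nat \<Rightarrow> 'a set" where "\<And>i. compactin X (K i)" "\<And>i. openin X (S i)"
    "\<And>i. K i \<subseteq> S i" "\<And>i. S i \<subseteq> K (Suc i)" "(\<Union>i. K i) = topspace X"
proof -
  define \<U> where "\<U> = {P. openin X P \<and> (\<exists>C. compactin X C \<and> P \<subseteq> C)}"
  have "\<Union>\<U> \<subseteq> topspace X" by (auto simp: \<U>_def dest: openin_subset)
  moreover have "topspace X \<subseteq> \<Union>\<U>"
  proof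
    fix p assume "p \<in> topspace X"
    from nbhd[OF this] show "p \<in> \<Union>\<U>" by (auto simp: \<U>_def)
  qed
  ultimately have "(\<forall>U\<in>\<U>. openin X U) \<and> \<Union>\<U> = topspace X" by (auto simp: \<U>_def)
  with lind have "\<exists>\<V>. countable \<V> \<and> \<V> \<subseteq> \<U> \<and> \<Union>\<V> = topspace X"
    unfolding Lindelof_space_def by (elim allE[of _ \<U>] mp)
  then obtain \<V> where \<V>: "countable \<V>" "\<V> \<subseteq> \<U>" "\<Union>\<V> = topspace X"
    by (elim exE conjE)
  \<comment> \<open>The empty set is added so that an enumeration exists even if the cover, and
    hence the space, is empty.\<close>
  define P where "P = from_nat_into (insert {} \<V>)"
  have ran: "range P = insert {} \<V>"
    unfolding P_def using \<V>(1) by (intro range_from_nat_into) auto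
  have "{} \<in> \<U>" by (auto simp: \<U>_def)
  then have "range P \<subseteq> \<U>" unfolding ran using \<V>(2) by simp
  then have PU: "P i \<in> \<U>" for i by (rule subsetD) (rule rangeI)
  then have opP: "openin X (P i)" and ex_C: "\<exists>C. compactin X C \<and> P i \<subseteq> C" for i
    by (simp_all add: \<U>_def)
  have "\<forall>i. \<exists>C. compactin X C \<and> P i \<subseteq> C" by (intro allI ex_C)
  from choice[OF this] obtain C where C: "\<And>i. compactin X (C i)" "\<And>i. P i \<subseteq> C i" by auto
  have UP: "(\<Union>i. P i) = topspace X" using ran \<V>(3) by auto
  have ex_g: "\<exists>n'. (\<Union>j<n. C j) \<subseteq> (\<Union>j<n'. P j)" for n
  proof -
    have "compactin X (\<Union>j<n. C j)" using C(1) by (intro compactin_Union) auto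
    moreover have "(\<Union>j<n. C j) \<subseteq> \<Union>(range P)"
      using compactin_subset_topspace[OF C(1)] UP by blast
    ultimately obtain \<F> where \<F>: "finite \<F>" "\<F> \<subseteq> range P" "(\<Union>j<n. C j) \<subseteq> \<Union>\<F>"
      using compactinD[of X "\<Union>j<n. C j" "range P"] opP by blast
    obtain J where J: "finite J" "\<F> = P ` J" using \<F>(1,2) finite_subset_image by metis
    obtain n' where "J \<subseteq> {..<n'}" using J(1) finite_nat_iff_bounded by blast
    then have "\<Union>\<F> \<subseteq> (\<Union>j<n'. P j)" using J(2) by blast
    with \<F>(3) have "(\<Union>j<n. C j) \<subseteq> (\<Union>j<n'. P j)" by (rule order_trans)
    then show ?thesis by (rule exI)
  qed
  have "\<forall>n. \<exists>n'. (\<Union>j<n. C j) \<subseteq> (\<Union>j<n'. P j)" by (intro allI ex_g)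
  from choice[OF this] obtain g where g: "\<And>n. (\<Union>j<n. C j) \<subseteq> (\<Union>j<g n. P j)" by auto
  \<comment> \<open>\<open>g\<close> makes the next open union cover the current compact one; the
    second argument of \<open>max\<close> makes \<open>s\<close> unbounded, so that every
    \<open>P i\<close> is reached.\<close>
  define s where "s = rec_nat 0 (\<lambda>_ n. max (g n) (Suc n))"
  have s_Suc: "s (Suc i) = max (g (s i)) (Suc (s i))" for i by (simp add: s_def)
  have s_ge: "i \<le> s i" for i by (induction i) (auto simp: s_Suc)
  show ?thesis
  proof
    fix i
    show "compactin X (\<Union>j<s i. C j)" using C(1) by (intro compactin_Union) auto
    show "openin X (\<Union>j<s (Suc i). P j)" using opP by auto
    have "(\<Union>j<g (s i). P j) \<subseteq> (\<Union>j<s (Suc i). P j)" by (rule UN_mono) (auto simp: s_Suc)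
    with g[of "s i"] show "(\<Union>j<s i. C j) \<subseteq> (\<Union>j<s (Suc i). P j)" by (rule order_trans)
    show "(\<Union>j<s (Suc i). P j) \<subseteq> (\<Union>j<s (Suc i). C j)" by (intro UN_mono C order_refl)
  next
    show "(\<Union>i. \<Union>j<s i. C j) = topspace X"
    proof
      show "(\<Union>i. \<Union>j<s i. C j) \<subseteq> topspace X" by (intro UN_least compactin_subset_topspace C)
      have "P i \<subseteq> (\<Union>j<s (Suc i). C j)" for i
        using C(2)[of i] s_ge[of "Suc i"] by (auto intro!: bexI[of _ i])
      also have "(\<Union>j<s (Suc i). C j) \<subseteq> (\<Union>i. \<Union>j<s i. C j)" for i by (rule UN_upper) simp
      finally show "topspace X \<subseteq> (\<Union>i. \<Union>j<s i. C j)" unfolding UP[symmetric] by (rule UN_least)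
    qed
  qed
qed

section \<open>The limit of the successive corrections\<close>

context projected_manifold
begin

lemma totally_real_map_exists:
  fixes Y :: "('r::euclidean_space \<times> 'r) set"
  assumes Y: "subspace Y" "3 * dim V \<le> dim Y + 1"
  obtains F where "smooth_fun F" "\<And>q. F q \<in> Y" "\<And>q. q \<in> topspace X \<Longrightarrow> totally_real_at F q"
proof -
  have nb: "\<exists>P C. openin X P \<and> compactin X C \<and> p \<in> P \<and> P \<subseteq> C" if p: "p \<in> topspace X" for p
  proof -
    obtain P C where "openin X P" "compactin X C" "p \<in> P" "P \<subseteq> C" "C \<subseteq> topspace X" "correctable Y C (topspace X)"
      by (rule correctable_nbhd[OF Y openin_topspace p])
    then show ?thesis by blast
  qed
  obtain K S where K: "\<And>i. compactin X (K i)" and S: "\<And>i. openin X (S i)" and KS: "\<And>i::nat. K i \<subseteq> S i"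
    and SK: "\<And>i. S i \<subseteq> K (Suc i)" and UK: "(\<Union>i. K i) = topspace X"
    by (rule compact_exhaustion[OF second_countable_imp_Lindelof_space[OF second_countable]], erule nb)
       (rule that)
  \<comment> \<open>The shift is deliberate: \<open>F n\<close> is already good on
    \<open>K (Suc n)\<close>, but later maps are kept equal to it only on \<open>K n\<close>. The
    gap leaves room for supports.\<close>
  have "\<exists>F. \<forall>n. totally_real_on Y (F n) (K (Suc n)) \<and> (\<forall>q\<in>K n. F (Suc n) q = F n q)"
  proof (rule dependent_nat_choice)
    have "totally_real_on Y (\<lambda>q. 0) {}"
      using Y(1) by (auto simp: totally_real_on_def smooth_fun_const subspace_0)
    moreover have "correctable Y (K (Suc 0)) (topspace X)"
      by (rule correctable_compact[OF Y K compactin_subset_topspace[OF K] openin_topspace])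
    ultimately show "\<exists>F. totally_real_on Y F (K (Suc 0))"
      unfolding correctable_def using compactin_empty by fastforce
  next
    fix F n assume F: "totally_real_on Y F (K (Suc n))"
    \<comment> \<open>Points of \<open>S n\<close> lie in \<open>K (Suc n)\<close> and are good
      already, so only \<open>?L\<close> needs work. It misses \<open>K n\<close>, since
      \<open>K n\<close> lies in \<open>S n\<close>, and so it can be corrected inside
      \<open>?O\<close>.\<close>
    let ?L = "K (Suc (Suc n)) - S n" and ?O = "topspace X - K n"
    have "closedin X (topspace X - S n)" using S by blast
    moreover have "?L = (topspace X - S n) \<inter> K (Suc (Suc n))"
      using compactin_subset_topspace[OF K] by blast
    ultimately have L: "compactin X ?L" using closed_Int_compactin[OF _ K] by metis
    have O: "openin X ?O" using compactin_imp_closedin[OF hausdorff K] by blast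
    have "?L \<subseteq> ?O" using KS compactin_subset_topspace[OF K] by blast
    then have "correctable Y ?L ?O" using correctable_compact[OF Y L _ O] by blast
    then obtain F' where F': "totally_real_on Y F' (K (Suc n) \<union> ?L)" "\<forall>q. q \<notin> ?O \<longrightarrow> F' q = F q"
      using K F unfolding correctable_def by blast
    have "totally_real_on Y F' (K (Suc (Suc n)))"
      by (rule totally_real_on_mono[OF F'(1)]) (use SK in blast)
    then show "\<exists>F'. totally_real_on Y F' (K (Suc (Suc n))) \<and> (\<forall>q\<in>K n. F' q = F q)"
      using F'(2) by blast
  qed
  then obtain F where F: "\<And>n. totally_real_on Y (F n) (K (Suc n))" and FS: "\<And>n q. q \<in> K n \<Longrightarrow> F (Suc n) q = F n q"
    by blast
  have Kmono: "K i \<subseteq> K j" if "i \<le> j" for i j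
    by (rule lift_Suc_mono_le[OF _ that]) (use KS SK in blast)
  have Feq: "F j q = F i q" if "q \<in> K i" "i \<le> j" for i j q
    using that(2)
  proof (induction j rule: dec_induct)
    case (step m)
    then show ?case using FS[of q m] Kmono[of i m] that(1) by auto
  qed simp
  define F\<^sub>0 where "F\<^sub>0 q = F (LEAST i. q \<in> K i) q" for q
  have F\<^sub>0: "F\<^sub>0 q = F i q" if "q \<in> K i" for i q
    unfolding F\<^sub>0_def using Feq[of q "LEAST i. q \<in> K i" i] LeastI[of "\<lambda>i. q \<in> K i" i] Least_le[of "\<lambda>i. q \<in> K i" i] that
    by simp
  have loc: "\<exists>i. q \<in> S i" if "q \<in> topspace X" for q using that UK KS by blast
  \<comment> \<open>On the open set \<open>S i\<close> the limit is a single smooth map, so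
    smoothness and total reality, both local, pass to it.\<close>
  have F\<^sub>0_S: "F\<^sub>0 q = F (Suc i) q" if "q \<in> S i" for i q using F\<^sub>0 SK that by blast
  show ?thesis
  proof
    show "smooth_fun F\<^sub>0"
    proof (rule smooth_fun_local)
      fix q assume "q \<in> topspace X"
      then obtain i where "q \<in> S i" using loc by blast
      then show "\<exists>S G. openin X S \<and> q \<in> S \<and> smooth_fun G \<and> (\<forall>p\<in>S. F\<^sub>0 p = G p)"
        using S F[of "Suc i"] F\<^sub>0_S unfolding totally_real_on_def by blast
    qed
    \<comment> \<open>This also covers \<open>q\<close> outside the space: the \<open>LEAST\<close>
      index is then unspecified, but every \<open>F n\<close> maps into \<open>Y\<close>.\<close>
    show "F\<^sub>0 q \<in> Y" for q unfolding F\<^sub>0_def using F by (auto simp: totally_real_on_def)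
    show "totally_real_at F\<^sub>0 q" if "q \<in> topspace X" for q
    proof -
      obtain i where i: "q \<in> S i" using loc \<open>q \<in> topspace X\<close> by blast
      then have "q \<in> K (Suc (Suc i))" using SK KS by blast
      then have "totally_real_at (F (Suc i)) q" using F[of "Suc i"] by (simp add: totally_real_on_def)
      then show ?thesis using totally_real_at_cong[OF S i, of F\<^sub>0 "F (Suc i)"] F\<^sub>0_S by simp
    qed
  qed
qed

end

section \<open>Immersions into complex space\<close>

text \<open>Derivatives within \<open>V\<close> are in general not determined off \<open>V\<close>.
  Along the line through \<open>x\<close> in a direction of \<open>V\<close> the problem becomes
  one-dimensional and unrestricted, where uniqueness holds.\<close>

lemma has_derivative_within_subspace_unique:
  assumes D: "(g has_derivative D) (at x within V)" "(g has_derivative D') (at x within V)"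
    and V: "subspace V" "x \<in> V" "v \<in> V"
  shows "D v = D' v"
proof -
  have line: "((\<lambda>t::real. x + t *\<^sub>R v) has_derivative (\<lambda>t. t *\<^sub>R v)) (at 0)"
    by (auto intro!: derivative_eq_intros)
  have "range (\<lambda>t::real. x + t *\<^sub>R v) \<subseteq> V"
    using V by (auto intro: subspace_add subspace_scale)
  then have "((\<lambda>t::real. g (x + t *\<^sub>R v)) has_derivative (\<lambda>t. E (t *\<^sub>R v))) (at 0)"
    if "(g has_derivative E) (at x within V)" for E
    using has_derivative_in_compose[OF line, of g E] has_derivative_subset[OF that] by simp
  from has_derivative_unique[OF this[OF D(1)] this[OF D(2)]]
  show ?thesis by (metis scaleR_one)
qed

context projected_manifold
begin

text \<open>A projection onto \<open>Y\<close> leaves the map unchanged, hence its derivative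
  too.\<close>

lemma chart_deriv_in_subspace:
  fixes F :: "'a \<Rightarrow> 'w::euclidean_space"
  assumes F: "smooth_fun F" "\<And>q. F q \<in> Y" and Y: "subspace Y" and c: "c \<in> A" "q \<in> fst c"
  shows "chart_deriv c F q u \<in> Y"
proof -
  obtain \<rho> where \<rho>: "linear \<rho>" "\<And>w. \<rho> w \<in> Y" "\<And>w. w \<in> Y \<Longrightarrow> \<rho> w = w"
    using linear_projection_exists[OF Y] by blast
  have "((\<lambda>x. \<rho> (chart_rep c F x)) has_derivative (\<lambda>u. \<rho> (chart_deriv c F q u))) (at (snd c q))"
    using \<rho>(1) unfolding linear_conv_bounded_linear
    by (rule bounded_linear.has_derivative[OF _ chart_deriv_works[OF F(1) c]])
  moreover have "(\<lambda>x. \<rho> (chart_rep c F x)) = chart_rep c F"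
    using F(2) \<rho>(3) by (simp add: chart_rep_def fun_eq_iff)
  ultimately have "chart_deriv c F q = (\<lambda>u. \<rho> (chart_deriv c F q u))"
    using has_derivative_unique chart_deriv_works[OF F(1) c] by metis
  then show ?thesis using \<rho>(2) by metis
qed

text \<open>This links the derivative within \<open>V\<close>, used to state the theorem, with the
  derivative at an interior point, used to prove it.\<close>

lemma differential_in_chart_bounded_linear:
  assumes F: "smooth_fun F" and L: "\<And>i. bounded_linear (L i)" and c: "c \<in> A" "q \<in> fst c" and v: "v \<in> V"
  shows "differential_in_chart V c (\<lambda>q i. L i (F q)) q v = (\<lambda>i. L i (chart_deriv c F q v))"
proof
  fix i
  let ?x = "snd c q" and ?g = "\<lambda>x. L i (F (chart_inv c x))"
  have x: "?x \<in> V" using chart_in_V c by blast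
  have "((\<lambda>x. L i (chart_rep c F x)) has_derivative (\<lambda>v. L i (chart_deriv c F q v))) (at ?x within V)"
    by (rule has_derivative_at_withinI[OF bounded_linear.has_derivative[OF L chart_deriv_works[OF F c]]])
  then have g: "(?g has_derivative (\<lambda>v. L i (chart_deriv c F q v))) (at ?x within V)"
    by (rule has_derivative_transform[OF x, rotated]) (simp add: chart_rep_def \<pi>_id)
  then have "?g differentiable (at ?x within V)" by (rule differentiableI)
  then have "(?g has_derivative frechet_derivative ?g (at ?x within V)) (at ?x within V)"
    by (simp only: frechet_derivative_works)
  then show "differential_in_chart V c (\<lambda>q i. L i (F q)) q v i = L i (chart_deriv c F q v)"
    unfolding differential_in_chart_def
    by (rule has_derivative_within_subspace_unique[OF _ g subspace_V x v])
qed

text \<open>The \<open>L i\<close> are complex-linear coordinates that separate points of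
  \<open>Y\<close>, so they carry \<open>mult_i\<close> to multiplication by i and transfer the
  injectivity of the complexified differential.\<close>

lemma totally_real_immersion_bounded_linear:
  fixes F :: "'a \<Rightarrow> 'r::euclidean_space \<times> 'r" and L :: "nat \<Rightarrow> 'r \<times> 'r \<Rightarrow> complex"
  assumes F: "smooth_fun F" "\<And>q. F q \<in> Y" "\<And>q. q \<in> topspace X \<Longrightarrow> totally_real_at F q"
    and Y: "subspace Y" "\<And>w. w \<in> Y \<Longrightarrow> mult_i w \<in> Y"
    and L: "\<And>i. bounded_linear (L i)" "\<And>i w. L i (mult_i w) = \<i> * L i w" "\<And>i w. i \<ge> N \<Longrightarrow> L i w = 0"
      "\<And>w. w \<in> Y \<Longrightarrow> (\<And>i. L i w = 0) \<Longrightarrow> w = 0"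
  shows "totally_real_immersion V X A N (\<lambda>q i. L i (F q))"
proof -
  let ?f = "\<lambda>q i. L i (F q)"
  have map: "smooth_map_to_complex_space X A N ?f"
    unfolding smooth_map_to_complex_space_def
  proof (intro conjI)
    show "?f ` topspace X \<subseteq> complex_space N" by (auto simp: complex_space_def intro: L(3))
    have "smooth_on (snd c ` fst c) (\<lambda>x. L i (F (chart_inv c x)))" if "c \<in> A" for c i
      by (rule smooth_on_chart[OF smooth_fun_bounded_linear[OF L(1) F(1)] that])
    then show "\<forall>(U, \<phi>)\<in>A. \<forall>i<N. smooth_on (\<phi> ` U) (\<lambda>x. L i (F (inv_into U \<phi> x)))"
      by fastforce
  qed
  \<comment> \<open>Both remaining claims are instances: \<open>v = 0\<close> gives injectivity of
    the differential, general \<open>v\<close> the trivial intersection with i times the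
    image.\<close>
  have inj0: "chart_deriv c F q u = 0 \<and> u = 0 \<and> v = 0"
    if c: "c \<in> A" "q \<in> fst c" and uv: "u \<in> V" "v \<in> V"
      and eq: "\<And>i. L i (chart_deriv c F q u) = \<i> * L i (chart_deriv c F q v)" for c q u v
  proof -
    let ?D = "chart_deriv c F q"
    have lin: "linear ?D" by (rule linear_chart_deriv[OF F(1) c])
    have "?D u - mult_i (?D v) \<in> Y"
      using chart_deriv_in_subspace[OF F(1,2) Y(1) c] Y by (simp add: subspace_diff)
    moreover have "L i (?D u - mult_i (?D v)) = 0" for i
      using eq[of i] L(2) by (simp add: linear_diff[OF bounded_linear.linear[OF L(1)]])
    ultimately have "?D u - mult_i (?D v) = 0" by (rule L(4))
    then have "?D u + mult_i (?D (- v)) = 0"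
      by (simp add: linear_neg[OF lin] linear_neg[OF linear_mult_i])
    moreover have "totally_real_at F q" using F(3) chartD(5)[OF c(1)] c(2) by blast
    moreover have "- v \<in> V" using uv(2) subspace_V by (simp add: subspace_neg)
    ultimately have "u = 0" "- v = 0"
      using c uv(1) unfolding totally_real_at_def by blast+
    then show ?thesis using linear_0[OF lin] by simp
  qed
  note diff = differential_in_chart_bounded_linear[where L = L, OF F(1) L(1)]
  have L0: "L i 0 = 0" for i by (rule linear_0[OF bounded_linear.linear[OF L(1)]])
  have "inj_on (differential_in_chart V c ?f q) V" if c: "c \<in> A" "q \<in> fst c" for c q
  proof (rule inj_onI)
    fix u v assume uv: "u \<in> V" "v \<in> V" and h: "differential_in_chart V c ?f q u = differential_in_chart V c ?f q v"
    have eq: "L i (chart_deriv c F q u) = L i (chart_deriv c F q v)" for i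
      using fun_cong[OF h, of i] by (simp only: diff[OF c uv(1)] diff[OF c uv(2)])
    have lin: "linear (chart_deriv c F q)" by (rule linear_chart_deriv[OF F(1) c])
    have "L i (chart_deriv c F q (u - v)) = \<i> * L i (chart_deriv c F q 0)" for i
      using eq[of i] by (simp add: linear_diff[OF lin] linear_0[OF lin] L0
          linear_diff[OF bounded_linear.linear[OF L(1)]])
    then show "u = v"
      using inj0[OF c, of "u - v" 0] uv subspace_V by (simp add: subspace_diff subspace_0)
  qed
  moreover have "differential_in_chart V c ?f q ` V \<inter> (\<lambda>z i. \<i> * z i) ` (differential_in_chart V c ?f q ` V) = {\<lambda>i. 0}"
    if c: "c \<in> A" "q \<in> fst c" for c q
  proof -
    have im: "differential_in_chart V c ?f q ` V = (\<lambda>v i. L i (chart_deriv c F q v)) ` V"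
      by (rule image_cong[OF refl diff[OF c]])
    have "chart_deriv c F q 0 = 0" by (rule linear_0[OF linear_chart_deriv[OF F(1) c]])
    then have zero: "(\<lambda>i. 0) = (\<lambda>i. L i (chart_deriv c F q 0))" using L0 by simp
    show ?thesis
      unfolding im
    proof (intro equalityI subsetI; (elim IntE imageE)?)
      fix z z' u v assume uv: "u \<in> V" "z = (\<lambda>i. L i (chart_deriv c F q u))"
        "v \<in> V" "z' = (\<lambda>i. L i (chart_deriv c F q v))" "z = (\<lambda>i. \<i> * z' i)"
      then have "L i (chart_deriv c F q u) = \<i> * L i (chart_deriv c F q v)" for i by metis
      then have "chart_deriv c F q u = 0" using inj0[OF c uv(1,3)] by blast
      then show "z \<in> {\<lambda>i. 0}" using uv(2) L0 by simp
    next
      fix z :: "nat \<Rightarrow> complex" assume "z \<in> {\<lambda>i. 0}"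
      then have z: "z = (\<lambda>i. L i (chart_deriv c F q 0))" "z = (\<lambda>i. \<i> * L i (chart_deriv c F q 0))"
        using zero by (auto simp: fun_eq_iff)
      have V0: "0 \<in> V" using subspace_V by (rule subspace_0)
      let ?T = "(\<lambda>v i. L i (chart_deriv c F q v)) ` V"
      have "(\<lambda>i. L i (chart_deriv c F q 0)) \<in> ?T" using V0 by (rule imageI)
      then have "z \<in> ?T" "(\<lambda>i. \<i> * L i (chart_deriv c F q 0)) \<in> (\<lambda>z i. \<i> * z i) ` ?T"
        using z(1) by (auto intro!: imageI)
      then show "z \<in> ?T \<inter> (\<lambda>z i. \<i> * z i) ` ?T" using z(2) by simp
    qed
  qed
  ultimately show ?thesis
    using map unfolding totally_real_immersion_def smooth_immersion_def Let_def by blast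
qed

end

theorem theorem1p1:
  fixes n N :: nat
    and V :: "(real^'m) set"
    and M :: "'a topology"
    and A :: "('a set \<times> ('a \<Rightarrow> real^'m)) set"
  assumes "smooth_manifold n V M A"
    and "int N \<ge> \<lfloor>3 * real n / 2\<rfloor>"
  shows "\<exists>f. totally_real_immersion V M A N f"
proof -
  have V: "subspace V" "dim V = n" and mfd: "Hausdorff_space M" "second_countable M" "smooth_atlas V M A"
    using assms(1) by (auto simp: smooth_manifold_def)
  obtain \<pi> where "linear \<pi>" "\<And>x. \<pi> x \<in> V" "\<And>x. x \<in> V \<Longrightarrow> \<pi> x = x"
    using linear_projection_exists[OF V(1)] by blast
  then interpret projected_manifold V M A \<pi>
    using V(1) mfd by (intro projected_manifold.intro)
  define m where "m = 3 * n div 2"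
  have "\<lfloor>3 * real n / 2\<rfloor> = int m"
    using floor_divide_of_nat_eq[of "3 * n" 2] by (simp add: m_def)
  then have mN: "m \<le> N" using assms(2) by simp
  \<comment> \<open>Room for \<open>R\<close>: \<open>real^'m\<close> alone may have dimension n,
    less than [3n/2], while its square has dimension at least 2n.\<close>
  have "n \<le> CARD('m)" using V(2) dim_subset_UNIV[of V] by simp
  then have "m \<le> dim (UNIV :: ((real^'m) \<times> (real^'m)) set)" by (simp add: m_def)
  then obtain R :: "((real^'m) \<times> (real^'m)) set" where R: "subspace R" "dim R = m"
    by (rule choose_subspace_of_subspace) blast
  obtain B where B: "finite B" "span B = R" "card B = m"
    using basis_subspace_exists[OF R(1)] R(2) by metis
  obtain e where e: "bij_betw e {0..<m} B"
    using ex_bij_betw_nat_finite[OF B(1)] B(3) by blast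
  define L where "L i w = (if i < m then Complex (fst w \<bullet> e i) (snd w \<bullet> e i) else 0)"
    for i and w :: "((real^'m) \<times> (real^'m)) \<times> (real^'m) \<times> (real^'m)"
  have Y: "subspace (R \<times> R)" by (intro subspace_Times R)
  \<comment> \<open>\<open>dim (R \<times> R)\<close> is 2m, and the integer division in
    \<open>m\<close> loses at most one half, so 2m \<ge> 3n - 1.\<close>
  moreover have "3 * dim V \<le> dim (R \<times> R) + 1"
    by (simp add: dim_Times R V m_def)
  ultimately obtain F where F: "smooth_fun F" "\<And>q. F q \<in> R \<times> R"
    "\<And>q. q \<in> topspace M \<Longrightarrow> totally_real_at F q"
    by (rule totally_real_map_exists) (rule that)
  have R0: "x = 0" if "x \<in> R" "\<And>i. i < m \<Longrightarrow> x \<bullet> e i = 0" for x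
  proof -
    have "orthogonal x b" if "b \<in> B" for b
      using e \<open>b \<in> B\<close> \<open>\<And>i. i < m \<Longrightarrow> x \<bullet> e i = 0\<close> by (force simp: orthogonal_def bij_betw_def)
    then have "orthogonal x x" using orthogonal_to_span[of x B x] that(1) B(2) by blast
    then show ?thesis by (simp add: orthogonal_self)
  qed
  have "totally_real_immersion V M A N (\<lambda>q i. L i (F q))"
  proof (rule totally_real_immersion_bounded_linear[OF F Y])
    show "bounded_linear (L i)" for i
      unfolding linear_conv_bounded_linear[symmetric]
    proof (rule linearI)
      show "L i (w + w') = L i w + L i w'" for w w'
        by (simp add: L_def inner_add_left complex_eq_iff)
      show "L i (r *\<^sub>R w) = r *\<^sub>R L i w" for r w
        by (simp add: L_def complex_eq_iff)
    qed
    show "mult_i w \<in> R \<times> R" if "w \<in> R \<times> R" for w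
      using that subspace_neg[OF R(1), of "snd w"] by (simp add: mult_i_def mem_Times_iff)
    show "L i (mult_i w) = \<i> * L i w" for i w
      by (simp add: L_def mult_i_def complex_eq_iff)
    show "L i w = 0" if "i \<ge> N" for i w using that mN by (simp add: L_def)
    show "w = 0" if "w \<in> R \<times> R" "\<And>i. L i w = 0" for w
    proof -
      have "fst w \<bullet> e i = 0 \<and> snd w \<bullet> e i = 0" if "i < m" for i
        using \<open>\<And>i. L i w = 0\<close>[of i] that by (simp add: L_def complex_eq_iff)
      then show ?thesis using R0[of "fst w"] R0[of "snd w"] that(1) by (auto simp: prod_eq_iff)
    qed
  qed
  then show ?thesis by blast
qed

end
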